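(* Let $n,p$ be integers with $2\le p\le n-2$, let $\beta>0$, and put $\alpha:=\frac{1}{2\beta}-1$. Let $\mathrm{St}_\beta(n,p)$ denote the Stiefel manifold $\mathrm{St}(n,p)$ endowed with the Riemannian metric $g$ with parameter $\beta$ described in the context. Let $$t^{\mathrm r}_\beta:=\min\left\{t>0 \;\middle|\; \frac{\sin t}{t}+(1+2\alpha)\cos t=0\right\}.$$ Let $Q\in\mathrm O(n)$ and consider $\xi=Q\begin{bmatrix}A\\H\end{bmatrix}\in \mathrm T_{QI_{n\times p}}\mathrm{St}(n,p)$ with $$A:=0_{p\times p},\qquad H:=\begin{bmatrix} I_2 & 0_{2\times(p-2)}\\ 0_{(n-p-2)\times 2} & 0_{(n-p-2)\times(p-2)}\end{bmatrix}\in\mathbb R^{(n-p)\times p}.$$ Let $\gamma$ denote the geodesic of $\mathrm{St}_\beta(n,p)$ starting at $QI_{n\times p}$ in the direction of $\xi$, namely $\gamma(t)=Q\exp_{\mathrm m}(t\Omega)I_{n\times p}\exp_{\mathrm m}(-t\Psi)=Q\exp_{\mathrm m}(t\Omega)I_{n\times p}$, where $$\Omega:=\begin{bmatrix}2\beta A & -H^\top\\ H & 0\end{bmatrix},\qquad \Psi:=-(1-2\beta)A=0_{p\times p}.$$ Then: (i) $\gamma(0)=QI_{n\times p}$ and $\gamma(t^{\mathrm r}_\beta)$ are conjugate along $\gamma$; moreover, $\gamma(0)$ and $\gamma(\pi)$ are conjugate along $\gamma$. (ii) For all $T>0$, the length (with respect to $g$) of $\gamma$ between $t=0$ and $t=T$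 is $T\sqrt2$. Thus $$\mathrm{conj}_{\mathrm{St}_\beta(n,p)}\le \min\{t^{\mathrm r}_\beta,\pi\}\sqrt2,$$ where the minimum is achieved by $t^{\mathrm r}_\beta$ when $\beta\le1$ and by $\pi$ when $\beta\ge1$.
   Context: Notation: $\mathrm{St}(n,p):=\{X\in\mathbb R^{n\times p}\mid X^\top X=I_p\}$ is the Stiefel manifold, a submanifold of $\mathbb R^{n\times p}$; $\mathrm O(n)$ is the orthogonal group; $\mathcal S_{\mathrm{skew}}(p)$ is the set of real skew-symmetric $p\times p$ matrices; $I_{n\times p}:=\begin{bmatrix}I_p\\0_{(n-p)\times p}\end{bmatrix}$; $\exp_{\mathrm m}$ is the matrix exponential. Every $X\in\mathrm{St}(n,p)$ can be written $X=QI_{n\times p}$ with $Q\in\mathrm O(n)$, and then $\mathrm T_X\mathrm{St}(n,p)=\left\{Q\begin{bmatrix}A\\H\end{bmatrix}\mid A\in\mathcal S_{\mathrm{skew}}(p),\ H\in\mathbb R^{(n-p)\times p}\right\}$. Metric: for $\beta>0$, and tangent vectors $\xi_{\mathrm a}=Q\begin{bmatrix}A_{\mathrm a}\\H_{\mathrm a}\end{bmatrix}$, $\xi_{\mathrm b}=Q\begin{bmatrix}A_{\mathrm b}\\H_{\mathrm b}\end{bmatrix}$ at $QI_{n\times p}$, $$g_{QI_{n\times p}}(\xi_{\mathrm a},\xi_{\mathrm b})=\beta\,\mathrm{trace}(A_{\mathrm a}^\top A_{\mathrm b})+\mathrm{trace}(H_{\mathrm a}^\top H_{\mathrm b}),$$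 which does not depend on the choice of $Q$. Conjugacy: on a complete Riemannian manifold $\mathcal M$ with Riemannian exponential map $\mathrm{Exp}_x:\mathrm T_x\mathcal M\to\mathcal M$, the point $\mathrm{Exp}_x(t\xi)$ is said to be conjugate to $x$ along the geodesic $t\mapsto\mathrm{Exp}_x(t\xi)$ if $t\xi$ is a critical point of $\mathrm{Exp}_x$, i.e., the derivative $\mathrm D\mathrm{Exp}_x(t\xi)$ is singular. The conjugate radius $\mathrm{conj}_{\mathcal M}(x)$ of $x$ is the supremum of the radii of open balls centered at the origin of $\mathrm T_x\mathcal M$ that contain no critical point of $\mathrm{Exp}_x$. On $\mathrm{St}_\beta(n,p)$, left multiplication by elements of $\mathrm O(n)$ is a transitive isometric action, so the conjugate radius is the same at every point; this common value is denoted $\mathrm{conj}_{\mathrm{St}_\beta(n,p)}$. *)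

theory Defs
  imports "HOL-Analysis.Analysis"
begin

section \<open>Smooth maps\<close>

text \<open>All iterated directional derivatives up to order \<open>k\<close> exist and are continuous.
  Meant for open \<open>S\<close> only, and for finite-dimensional domains, where it is the usual
  class \<open>C\<^sup>k\<close>.\<close>

primrec Ck_on :: "nat \<Rightarrow> 'a::real_normed_vector set \<Rightarrow> ('a \<Rightarrow> 'b::real_normed_vector) \<Rightarrow> bool" where
  "Ck_on 0 S f \<longleftrightarrow> continuous_on S f"
| "Ck_on (Suc k) S f \<longleftrightarrow>
     (\<forall>x\<in>S. f differentiable (at x)) \<and> (\<forall>v. Ck_on k S (\<lambda>x. frechet_derivative f (at x) v))"

definition smooth_on :: "'a::real_normed_vector set \<Rightarrow> ('a \<Rightarrow> 'b::real_normed_vector) \<Rightarrow> bool" where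
  "smooth_on S f \<longleftrightarrow> (\<forall>k. Ck_on k S f)"

section \<open>Riemannian geometry of embedded manifolds\<close>

text \<open>A manifold is given by a subset \<open>M\<close> of a Euclidean space \<open>'a\<close>, its tangent spaces
  \<open>T x\<close> as linear subspaces of \<open>'a\<close>, and its metric \<open>g x\<close>, of which only the values on
  \<open>T x\<close> matter. The metric need not be the one induced by \<open>'a\<close>.\<close>

definition curve_length ::
  "('a::euclidean_space \<Rightarrow> 'a \<Rightarrow> 'a \<Rightarrow> real) \<Rightarrow> (real \<Rightarrow> 'a) \<Rightarrow> real \<Rightarrow> real \<Rightarrow> real" where
  "curve_length g \<gamma> a b =
     integral {a..b} (\<lambda>t. sqrt (g (\<gamma> t) (vector_derivative \<gamma> (at t)) (vector_derivative \<gamma> (at t))))"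

definition curve_energy ::
  "('a::euclidean_space \<Rightarrow> 'a \<Rightarrow> 'a \<Rightarrow> real) \<Rightarrow> (real \<Rightarrow> 'a) \<Rightarrow> real \<Rightarrow> real \<Rightarrow> real" where
  "curve_energy g \<gamma> a b =
     1 / 2 * integral {a..b} (\<lambda>t. g (\<gamma> t) (vector_derivative \<gamma> (at t)) (vector_derivative \<gamma> (at t)))"

text \<open>Smooth variations \<open>\<Gamma> (s, t)\<close> of \<open>\<gamma>\<close> within \<open>M\<close>, with endpoints fixed at \<open>t = a\<close> and
  \<open>t = b\<close>.\<close>

definition proper_variation ::
  "'a::euclidean_space set \<Rightarrow> (real \<Rightarrow> 'a) \<Rightarrow> real \<Rightarrow> real \<Rightarrow> real \<Rightarrow> (real \<times> real \<Rightarrow> 'a) \<Rightarrow> bool" where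
  "proper_variation M \<gamma> a b \<epsilon> \<Gamma> \<longleftrightarrow>
     smooth_on ({-\<epsilon><..<\<epsilon>} \<times> UNIV) \<Gamma> \<and> \<Gamma> ` ({-\<epsilon><..<\<epsilon>} \<times> UNIV) \<subseteq> M \<and>
     (\<forall>t. \<Gamma> (0, t) = \<gamma> t) \<and>
     (\<forall>s\<in>{-\<epsilon><..<\<epsilon>}. \<Gamma> (s, a) = \<gamma> a \<and> \<Gamma> (s, b) = \<gamma> b)"

text \<open>Geodesics, defined on all of \<open>\<real>\<close> since only complete manifolds are of interest, are
  the critical points of the energy functional.\<close>

definition geodesic ::
  "'a::euclidean_space set \<Rightarrow> ('a \<Rightarrow> 'a \<Rightarrow> 'a \<Rightarrow> real) \<Rightarrow> (real \<Rightarrow> 'a) \<Rightarrow> bool" where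
  "geodesic M g \<gamma> \<longleftrightarrow>
     smooth_on UNIV \<gamma> \<and> range \<gamma> \<subseteq> M \<and>
     (\<forall>a b \<epsilon> \<Gamma>. a < b \<longrightarrow> 0 < \<epsilon> \<longrightarrow> proper_variation M \<gamma> a b \<epsilon> \<Gamma> \<longrightarrow>
        ((\<lambda>s. curve_energy g (\<lambda>t. \<Gamma> (s, t)) a b) has_real_derivative 0) (at 0))"

definition geodesic_from ::
  "'a::euclidean_space set \<Rightarrow> ('a \<Rightarrow> 'a \<Rightarrow> 'a \<Rightarrow> real) \<Rightarrow> 'a \<Rightarrow> 'a \<Rightarrow> (real \<Rightarrow> 'a) \<Rightarrow> bool" where
  "geodesic_from M g x v \<gamma> \<longleftrightarrow>
     geodesic M g \<gamma> \<and> \<gamma> 0 = x \<and> (\<gamma> has_vector_derivative v) (at 0)"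

definition riem_exp ::
  "'a::euclidean_space set \<Rightarrow> ('a \<Rightarrow> 'a \<Rightarrow> 'a \<Rightarrow> real) \<Rightarrow> 'a \<Rightarrow> 'a \<Rightarrow> 'a" where
  "riem_exp M g x v = (THE \<gamma>. geodesic_from M g x v \<gamma>) 1"

text \<open>The derivative \<open>D\<close> is taken within \<open>T x\<close>, hence determined on \<open>T x\<close> only. There it maps
  into a tangent space of the same dimension, so that singular means not injective.\<close>

definition exp_critical ::
  "'a::euclidean_space set \<Rightarrow> ('a \<Rightarrow> 'a set) \<Rightarrow> ('a \<Rightarrow> 'a \<Rightarrow> 'a \<Rightarrow> real) \<Rightarrow> 'a \<Rightarrow> 'a \<Rightarrow> bool" where
  "exp_critical M T g x v \<longleftrightarrow>
     v \<in> T x \<and>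
     (\<exists>D. (riem_exp M g x has_derivative D) (at v within T x) \<and> \<not> inj_on D (T x))"

text \<open>\<open>Exp\<^sub>x (t \<xi>)\<close> is conjugate to \<open>x\<close> along the geodesic \<open>t \<mapsto> Exp\<^sub>x (t \<xi>)\<close>.\<close>

definition conjugate_along ::
  "'a::euclidean_space set \<Rightarrow> ('a \<Rightarrow> 'a set) \<Rightarrow> ('a \<Rightarrow> 'a \<Rightarrow> 'a \<Rightarrow> real) \<Rightarrow> 'a \<Rightarrow> 'a \<Rightarrow> real \<Rightarrow> bool" where
  "conjugate_along M T g x \<xi> t \<longleftrightarrow> exp_critical M T g x (t *\<^sub>R \<xi>)"

text \<open>An extended real, as there may be no critical point at all. The radius \<open>0\<close> is admitted so
  that the supremum is over a nonempty set.\<close>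

definition conj_radius ::
  "'a::euclidean_space set \<Rightarrow> ('a \<Rightarrow> 'a set) \<Rightarrow> ('a \<Rightarrow> 'a \<Rightarrow> 'a \<Rightarrow> real) \<Rightarrow> 'a \<Rightarrow> ereal" where
  "conj_radius M T g x =
     Sup {ereal r | r. 0 \<le> r \<and> (\<forall>v\<in>T x. sqrt (g x v v) < r \<longrightarrow> \<not> exp_critical M T g x v)}"

section \<open>Matrices\<close>

definition matrix_exp :: "real^'n^'n \<Rightarrow> real^'n^'n" where
  "matrix_exp A = (\<Sum>k. (1 / fact k) *\<^sub>R (((**) A ^^ k) (mat 1)))"

text \<open>The index type \<open>'p + 'q\<close> splits \<open>n = CARD('p + 'q)\<close> into the first \<open>p = CARD('p)\<close> indices
  and the last \<open>n - p = CARD('q)\<close> ones.\<close>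

definition stack :: "real^'p^'p \<Rightarrow> real^'p^'q \<Rightarrow> real^'p^('p + 'q)" where
  "stack A H = (\<chi> i. case i of Inl k \<Rightarrow> A $ k | Inr l \<Rightarrow> H $ l)"

definition block ::
  "real^'p^'p \<Rightarrow> real^'q^'p \<Rightarrow> real^'p^'q \<Rightarrow> real^'q^'q \<Rightarrow> real^('p + 'q)^('p + 'q)" where
  "block A B C D =
     (\<chi> i j. case i of
        Inl k \<Rightarrow> (case j of Inl k' \<Rightarrow> A $ k $ k' | Inr l' \<Rightarrow> B $ k $ l')
      | Inr l \<Rightarrow> (case j of Inl k' \<Rightarrow> C $ l $ k' | Inr l' \<Rightarrow> D $ l $ l'))"

definition I_np :: "real^'p^('p + 'q::finite)" where
  "I_np = stack (mat 1) 0"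

definition skew :: "real^'p^'p \<Rightarrow> bool" where
  "skew A \<longleftrightarrow> transpose A = - A"

section \<open>The Stiefel manifold\<close>

definition stiefel :: "(real^'p^('p + 'q::finite)) set" where
  "stiefel = {X. transpose X ** X = mat 1}"

definition stiefel_tangent :: "real^'p^('p + 'q::finite) \<Rightarrow> (real^'p^('p + 'q::finite)) set" where
  "stiefel_tangent X = {Q ** stack A H | Q A H. orthogonal_matrix Q \<and> X = Q ** I_np \<and> skew A}"

definition stiefel_metric ::
  "real \<Rightarrow> real^'p^('p + 'q::finite) \<Rightarrow> real^'p^('p + 'q::finite) \<Rightarrow> real^'p^('p + 'q::finite) \<Rightarrow> real" where
  "stiefel_metric \<beta> X \<xi>a \<xi>b =
     (THE r. \<exists>Q Aa Ha Ab Hb.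
        orthogonal_matrix Q \<and> X = Q ** I_np \<and>
        \<xi>a = Q ** stack Aa Ha \<and> \<xi>b = Q ** stack Ab Hb \<and>
        r = \<beta> * trace (transpose Aa ** Ab) + trace (transpose Ha ** Hb))"

lemma sum_UNIV_sum:
  fixes f :: "'p::finite + 'q::finite \<Rightarrow> real"
  shows "(\<Sum>i\<in>UNIV. f i) = (\<Sum>k\<in>UNIV. f (Inl k)) + (\<Sum>l\<in>UNIV. f (Inr l))"
  using sum.Plus[of "UNIV::'p set" "UNIV::'q set" f]
  unfolding UNIV_Plus_UNIV by (simp add: comp_def)

lemma trace_stack:
  "trace (transpose (stack A H) ** stack B K) =
     trace (transpose A ** B) + trace (transpose H ** (K :: real^'p^'q::finite))"
  by (simp add: trace_def transpose_def matrix_matrix_mult_def stack_def sum_UNIV_sum sum.distrib)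

lemma transpose_I_np_stack:
  "transpose I_np ** stack A (H :: real^'p^'q::finite) = A"
  by (simp add: vec_eq_iff transpose_def matrix_matrix_mult_def stack_def I_np_def mat_def
      sum_UNIV_sum mult_delta_left)

text \<open>The metric is well defined.\<close>

lemma stiefel_metric_eq:
  assumes Q: "orthogonal_matrix Q"
  shows "stiefel_metric \<beta> (Q ** I_np) (Q ** stack Aa Ha) (Q ** stack Ab Hb) =
    \<beta> * trace (transpose Aa ** Ab) + trace (transpose Ha ** (Hb :: real^'p^'q::finite))"
proof -
  have mult: "transpose (P ** Y) ** (P ** Z) = transpose Y ** Z" if "orthogonal_matrix P"
    for P :: "real^('p + 'q)^('p + 'q)" and Y Z :: "real^'p^('p + 'q)"
  proof -
    have "transpose P ** (P ** Z) = Z"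
      using that by (simp add: orthogonal_matrix_def matrix_mul_assoc)
    then show ?thesis
      by (simp add: matrix_transpose_mul matrix_mul_assoc[symmetric])
  qed
  define F where "F X \<xi>a \<xi>b = trace (transpose \<xi>a ** \<xi>b) -
      (1 - \<beta>) * trace (transpose (transpose X ** \<xi>a) ** (transpose X ** \<xi>b))"
    for X \<xi>a \<xi>b :: "real^'p^('p + 'q)"
  have F: "F (P ** I_np) (P ** stack A H) (P ** stack B K) =
      \<beta> * trace (transpose A ** B) + trace (transpose H ** K)" if "orthogonal_matrix P"
    for P and A B :: "real^'p^'p" and H K :: "real^'p^'q"
    using that by (simp add: F_def mult transpose_I_np_stack trace_stack algebra_simps)
  show ?thesis
    unfolding stiefel_metric_def
  proof (rule the_equality)
    show "\<exists>Q' Aa' Ha' Ab' Hb'. orthogonal_matrix Q' \<and> Q ** I_np = Q' ** I_np \<and>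
        Q ** stack Aa Ha = Q' ** stack Aa' Ha' \<and> Q ** stack Ab Hb = Q' ** stack Ab' Hb' \<and>
        \<beta> * trace (transpose Aa ** Ab) + trace (transpose Ha ** Hb) =
        \<beta> * trace (transpose Aa' ** Ab') + trace (transpose Ha' ** Hb')"
      using Q by blast
  next
    fix r
    assume "\<exists>Q' Aa' Ha' Ab' Hb'. orthogonal_matrix Q' \<and> Q ** I_np = Q' ** I_np \<and>
        Q ** stack Aa Ha = Q' ** stack Aa' Ha' \<and> Q ** stack Ab Hb = Q' ** stack Ab' Hb' \<and>
        r = \<beta> * trace (transpose Aa' ** Ab') + trace (transpose Ha' ** Hb')"
    then obtain Q' Aa' Ha' Ab' Hb' where Q': "orthogonal_matrix Q'"
      and eqs: "Q ** I_np = Q' ** I_np" "Q ** stack Aa Ha = Q' ** stack Aa' Ha'"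
        "Q ** stack Ab Hb = Q' ** stack Ab' Hb'"
      and r: "r = \<beta> * trace (transpose Aa' ** Ab') + trace (transpose Ha' ** Hb')"
      by blast
    show "r = \<beta> * trace (transpose Aa ** Ab) + trace (transpose Ha ** Hb)"
      using F[OF Q', of Aa' Ha' Ab' Hb'] F[OF Q, of Aa Ha Ab Hb] unfolding r eqs by simp
  qed
qed

definition t_r :: "real \<Rightarrow> real" where
  "t_r \<alpha> = (LEAST t. 0 < t \<and> sin t / t + (1 + 2 * \<alpha>) * cos t = 0)"

end

(* Idea: criticality of the energy under the variations exp (s (t - a) (b - t) Z) \<gamma>(t), Z skew,
   shows that along a geodesic \<gamma>\<^sup>T \<gamma>' is constant, so that \<gamma> solves a second-order equation with
   unique solutions; this identifies Exp_x with the closed formula Q exp(\<Omega>) I exp(-\<Psi>). At t \<xi>, perturb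
   in the direction A = a S, H' = b H S, where S is the rotation generator in the first two
   coordinates. On the relevant 4-dimensional subspace S is a complex structure and \<Omega> becomes a complex
   2 x 2 matrix, whose exponential is explicit; the derivative of Exp at t \<xi> is then proportional to
   a ((1 - \<beta>) cos t + \<beta> sin t / t) in one block and to sin t / t (t (1 - \<beta>) a + b) in the other.
   It vanishes at t_r for (a, b) = (1, - (1 - \<beta>) t_r), and at \<pi> for (a, b) = (0, 1). *)

theory Submission
  imports Defs
begin

subsection \<open>Matrix algebra and uniqueness for differential equations\<close>

text \<open>Geodesics are given only as critical points of the energy and \<open>riem_exp\<close>
  only as a definite description, so the closed formula must be shown both critical and unique
  before anything can be computed. To vary the energy, the frame \<open>Q\<close> is first
  eliminated: tangency becomes skewness of X^T v, and the metric becomes the Frobenius product minus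
  (1 - \<beta>) times the product of the X^T parts. The constancy of \<gamma>^T \<gamma>' is the
  conservation law of the right action of O(p), under which the metric is invariant; here it appears
  as the skew part of the Euler-Lagrange equation, with factor \<beta>. The perturbation of \<Omega>
  does not commute with \<Omega>, so its effect on the exponential cannot be read off directly. The
  choice with S S = - H^T H makes the perturbed exponential elementary for every size of the
  perturbation, and only scalar functions remain to be differentiated. The resulting linear system
  in (a, b) is triangular, and each of its two diagonal factors yields one conjugate point; the
  first is the equation of \<open>t_r\<close> because \<beta> (1 + 2 \<alpha>) = 1 - \<beta>. The
  factor \<open>sqrt 2\<close> is the Frobenius norm of \<open>H\<close>.\<close>

lemma bounded_bilinear_matrix_mult:
  "bounded_bilinear ((**) :: real^'n::finite^'m::finite \<Rightarrow> real^'p::finite^'n \<Rightarrow> real^'p^'m)"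
proof (rule bilinear_conv_bounded_bilinear[THEN iffD1])
  show "bilinear ((**) :: real^'n^'m \<Rightarrow> real^'p^'n \<Rightarrow> real^'p^'m)"
    unfolding bilinear_def
    by (auto intro!: linearI simp: vec_eq_iff matrix_matrix_mult_def sum.distrib
        algebra_simps sum_distrib_left)
qed

interpretation mat: bounded_bilinear
  "(**) :: real^'n::finite^'m::finite \<Rightarrow> real^'p::finite^'n \<Rightarrow> real^'p^'m"
  by (rule bounded_bilinear_matrix_mult)

lemma bounded_linear_transpose:
  "bounded_linear (transpose :: real^'n::finite^'m::finite \<Rightarrow> real^'m^'n)"
  by (auto intro!: linearI simp: linear_conv_bounded_linear[symmetric] vec_eq_iff transpose_def)

lemmas transpose_simps =
  linear_add[OF bounded_linear.linear[OF bounded_linear_transpose]]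
  linear_diff[OF bounded_linear.linear[OF bounded_linear_transpose]]
  linear_neg[OF bounded_linear.linear[OF bounded_linear_transpose]]
  linear_scale[OF bounded_linear.linear[OF bounded_linear_transpose]]
  linear_0[OF bounded_linear.linear[OF bounded_linear_transpose]]

lemmas mat_derivs [derivative_intros] =
  mat.has_vector_derivative bounded_linear.has_vector_derivative[OF bounded_linear_transpose]

lemma inner_matrix: "X \<bullet> Y = trace (transpose X ** Y)" for X Y :: "real^'p::finite^'n::finite"
  by (simp add: inner_vec_def trace_def transpose_def matrix_matrix_mult_def) (rule sum.swap)

lemma inner_matrix_mult_left: "(A ** X) \<bullet> Y = X \<bullet> (transpose A ** Y)"
  for A :: "real^'n::finite^'m::finite" and X :: "real^'p::finite^'n"
  by (simp add: inner_matrix matrix_transpose_mul matrix_mul_assoc)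

lemma inner_transpose [simp]: "transpose X \<bullet> transpose Y = X \<bullet> Y"
  for X Y :: "real^'p::finite^'n::finite"
  by (simp add: inner_vec_def transpose_def) (rule sum.swap)

lemma inner_matrix_mult_right: "(X ** A) \<bullet> Y = X \<bullet> (Y ** transpose A)"
  for A :: "real^'p::finite^'m::finite" and X :: "real^'m^'n::finite"
proof -
  have "(X ** A) \<bullet> Y = (transpose A ** transpose X) \<bullet> transpose Y"
    by (metis inner_transpose matrix_transpose_mul)
  also have "\<dots> = X \<bullet> (Y ** transpose A)"
    by (metis inner_matrix_mult_left inner_transpose matrix_transpose_mul transpose_transpose)
  finally show ?thesis .
qed

lemma norm_transpose [simp]: "norm (transpose X) = norm X" for X :: "real^'p::finite^'n::finite"
  by (simp add: norm_eq_sqrt_inner)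

text \<open>The norm of the vector type is the Frobenius norm, so Cauchy-Schwarz for each row
  against each column suffices. The constant 1 keeps the bounds for powers geometric.\<close>

lemma norm_matrix_mult: "norm (A ** B) \<le> norm A * norm B"
  for A :: "real^'n::finite^'m::finite" and B :: "real^'p::finite^'n"
proof -
  have B: "(\<Sum>k\<in>UNIV. column k B \<bullet> column k B) = B \<bullet> B"
    by (simp add: inner_vec_def column_def) (rule sum.swap)
  have entry: "(A ** B) $ i $ k = A $ i \<bullet> column k B" for i k
    by (simp add: matrix_matrix_mult_def inner_vec_def column_def)
  have "(A ** B) \<bullet> (A ** B) = (\<Sum>i\<in>UNIV. \<Sum>k\<in>UNIV. ((A ** B) $ i $ k)\<^sup>2)"
    by (simp add: inner_vec_def power2_eq_square)
  also have "\<dots> = (\<Sum>i\<in>UNIV. \<Sum>k\<in>UNIV. (A $ i \<bullet> column k B)\<^sup>2)"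
    by (simp only: entry)
  also have "\<dots> \<le> (\<Sum>i\<in>UNIV. \<Sum>k\<in>UNIV. (A $ i \<bullet> A $ i) * (column k B \<bullet> column k B))"
    by (intro sum_mono Cauchy_Schwarz_ineq)
  also have "\<dots> = (A \<bullet> A) * (B \<bullet> B)"
    unfolding sum_product[symmetric] B by (simp only: inner_vec_def[of A A])
  finally show ?thesis
    by (simp add: norm_eq_sqrt_inner real_sqrt_mult[symmetric])
qed

text \<open>The weight \<open>exp (- 2 M t)\<close> makes the square norm decreasing.\<close>

lemma gronwall_zero:
  fixes f f' :: "real \<Rightarrow> 'a::real_inner"
  assumes f: "\<And>t. \<bar>t\<bar> \<le> T \<Longrightarrow> (f has_vector_derivative f' t) (at t)"
    and bound: "\<And>t. \<bar>t\<bar> \<le> T \<Longrightarrow> norm (f' t) \<le> M * norm (f t)"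
    and "f 0 = 0" and t: "\<bar>t\<bar> \<le> T"
  shows "f t = 0"
proof -
  have main: "g x = 0" if g: "\<And>t. \<bar>t\<bar> \<le> T \<Longrightarrow> (g has_vector_derivative g' t) (at t)"
    and bound: "\<And>t. \<bar>t\<bar> \<le> T \<Longrightarrow> norm (g' t) \<le> M * norm (g t)"
    and "g 0 = 0" and x: "0 \<le> x" "x \<le> T" for g g' :: "real \<Rightarrow> 'a" and x
  proof -
    define u where "u t = exp (- (2 * M) * t) * (g t \<bullet> g t)" for t
    have "\<exists>y. (u has_real_derivative y) (at t) \<and> y \<le> 0" if "0 \<le> t" "t \<le> x" for t
    proof -
      have t: "\<bar>t\<bar> \<le> T" using that x by auto
      have "((\<lambda>t. g t \<bullet> g t) has_real_derivative 2 * (g t \<bullet> g' t)) (at t)"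
        using bounded_bilinear.has_vector_derivative[OF bounded_bilinear_inner g[OF t] g[OF t]]
        by (simp add: has_real_derivative_iff_has_vector_derivative inner_commute)
      then have "(u has_real_derivative
          (exp (- (2 * M) * t) * (2 * (g t \<bullet> g' t)) - 2 * M * exp (- (2 * M) * t) * (g t \<bullet> g t))) (at t)"
        unfolding u_def by (auto intro!: derivative_eq_intros simp: algebra_simps)
      moreover have "g t \<bullet> g' t \<le> M * (g t \<bullet> g t)"
      proof -
        have "g t \<bullet> g' t \<le> norm (g t) * norm (g' t)" by (rule norm_cauchy_schwarz)
        also have "\<dots> \<le> norm (g t) * (M * norm (g t))" using bound[OF t] by (intro mult_left_mono) auto
        also have "\<dots> = M * (g t \<bullet> g t)" by (simp add: dot_square_norm power2_eq_square)
        finally show ?thesis .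
      qed
      then have "exp (- (2 * M) * t) * (g t \<bullet> g' t - M * (g t \<bullet> g t)) \<le> 0"
        by (simp add: mult_le_0_iff)
      ultimately show ?thesis
        by (intro exI[of _ "exp (- (2 * M) * t) * (2 * (g t \<bullet> g' t)) - 2 * M * exp (- (2 * M) * t) * (g t \<bullet> g t)"])
          (simp add: algebra_simps)
    qed
    then have "u x \<le> u 0" using x by (intro DERIV_nonpos_imp_nonincreasing[of 0 x]) auto
    then have "g x \<bullet> g x \<le> 0"
      using \<open>g 0 = 0\<close> by (simp add: u_def mult_le_0_iff)
    then show ?thesis by (metis inner_ge_zero order.antisym inner_eq_zero_iff)
  qed
  show ?thesis
  proof (cases "t \<ge> 0")
    case True
    then show ?thesis using main[of f f' t] assms by auto
  next
    case False
    have "((\<lambda>t. f (- t)) has_vector_derivative - f' (- t)) (at t)" if "\<bar>t\<bar> \<le> T" for t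
    proof -
      have "((\<lambda>t. - t) has_vector_derivative - 1) (at t)" by (auto intro!: derivative_eq_intros)
      from vector_diff_chain_at[OF this, of f "f' (- t)"] f[of "- t"] that
      show ?thesis by (simp add: o_def)
    qed
    then show ?thesis using main[of "\<lambda>t. f (- t)" "\<lambda>t. - f' (- t)" "- t"] bound assms(3) t False by auto
  qed
qed

text \<open>Identities for exponentials are proved below by showing that both sides solve the same
  linear equation with the same initial value.\<close>

lemma linear_ode_unique:
  fixes f g :: "real \<Rightarrow> 'a::real_inner"
  assumes L: "bounded_linear L"
    and f: "\<And>t. (f has_vector_derivative L (f t)) (at t)"
    and g: "\<And>t. (g has_vector_derivative L (g t)) (at t)"
    and "f 0 = g 0"
  shows "f t = g t"
proof -
  interpret L: bounded_linear L by (rule L)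
  obtain K where K: "\<And>x. norm (L x) \<le> norm x * K" using L.bounded by blast
  have "f t - g t = 0"
    by (rule gronwall_zero[where T = "\<bar>t\<bar>" and M = K and f' = "\<lambda>t. L (f t) - L (g t)"])
      (auto intro!: derivative_eq_intros f g simp: assms(4) L.diff[symmetric] K mult.commute[of K])
  then show ?thesis by simp
qed

subsection \<open>Smooth maps\<close>

text \<open>Differentiability on an open set is local. \<open>frechet_derivative\<close> is a choice
  among derivatives, so it agrees for both functions once they have the same derivatives at each
  point.\<close>

lemma Ck_on_cong:
  assumes "open S" "\<And>x. x \<in> S \<Longrightarrow> f x = g x"
  shows "Ck_on k S f \<longleftrightarrow> Ck_on k S g"
  using assms(2)
proof (induction k arbitrary: f g)
  case 0
  then show ?case by (simp cong: continuous_on_cong)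
next
  case (Suc k)
  have d: "(f has_derivative D) (at x) \<longleftrightarrow> (g has_derivative D) (at x)" if "x \<in> S" for x D
    using has_derivative_transform_within_open[OF _ \<open>open S\<close> that, of f D UNIV g]
      has_derivative_transform_within_open[OF _ \<open>open S\<close> that, of g D UNIV f] Suc.prems by auto
  have "frechet_derivative f (at x) = frechet_derivative g (at x)" if "x \<in> S" for x
    using d[OF that] by (simp add: frechet_derivative_def)
  then have "Ck_on k S (\<lambda>x. frechet_derivative f (at x) v) \<longleftrightarrow>
      Ck_on k S (\<lambda>x. frechet_derivative g (at x) v)" for v
    by (intro Suc.IH) simp
  then show ?case using d by (simp add: differentiable_def)
qed

text \<open>Allows an explicit formula \<open>D\<close> in place of
  \<open>frechet_derivative\<close>, on which an induction over \<open>k\<close> can act.\<close>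

lemma Ck_on_SucI:
  assumes "open S" "\<And>x. x \<in> S \<Longrightarrow> (f has_derivative D x) (at x)"
    and "\<And>v. Ck_on k S (\<lambda>x. D x v)"
  shows "Ck_on (Suc k) S f"
proof -
  have "Ck_on k S (\<lambda>x. frechet_derivative f (at x) v) \<longleftrightarrow> Ck_on k S (\<lambda>x. D x v)" for v
    using assms(2) by (intro Ck_on_cong \<open>open S\<close>) (metis frechet_derivative_at)
  then show ?thesis using assms by (auto simp: differentiable_def)
qed

lemma Ck_on_SucD:
  assumes "Ck_on (Suc k) S f"
  shows "x \<in> S \<Longrightarrow> (f has_derivative frechet_derivative f (at x)) (at x)"
    and "Ck_on k S (\<lambda>x. frechet_derivative f (at x) v)"
  using assms by (auto simp: frechet_derivative_works)

lemma Ck_on_Suc_imp: "Ck_on (Suc k) S f \<Longrightarrow> Ck_on k S f"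
proof (induction k arbitrary: f)
  case 0
  then show ?case
    by (auto intro!: continuous_at_imp_continuous_on differentiable_imp_continuous_within)
qed auto

lemma Ck_on_const: "Ck_on k S (\<lambda>_. c)"
  by (induction k arbitrary: c) auto

lemma Ck_on_linear:
  assumes "open S" "bounded_linear L"
  shows "Ck_on k S L"
proof (cases k)
  case 0
  then show ?thesis by (simp add: linear_continuous_on assms)
next
  case (Suc m)
  then show ?thesis
    using Ck_on_SucI[OF \<open>open S\<close>, of L "\<lambda>_. L"] assms(2)
    by (auto intro: bounded_linear_imp_has_derivative Ck_on_const)
qed

lemma Ck_on_add:
  assumes "open S"
  shows "Ck_on k S f \<Longrightarrow> Ck_on k S g \<Longrightarrow> Ck_on k S (\<lambda>x. f x + g x)"
proof (induction k arbitrary: f g)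
  case 0
  then show ?case by (auto intro: continuous_intros)
next
  case (Suc k)
  show ?case
    by (rule Ck_on_SucI[OF \<open>open S\<close>, where D = "\<lambda>x v. frechet_derivative f (at x) v + frechet_derivative g (at x) v"])
      (auto intro!: has_derivative_add Suc.IH Ck_on_SucD[OF Suc.prems(1)] Ck_on_SucD[OF Suc.prems(2)])
qed

lemma Ck_on_bilinear:
  assumes "open S" "bounded_bilinear B"
  shows "Ck_on k S f \<Longrightarrow> Ck_on k S g \<Longrightarrow> Ck_on k S (\<lambda>x. B (f x) (g x))"
proof (induction k arbitrary: f g)
  case 0
  then show ?case using bounded_bilinear.continuous_on[OF assms(2)] by auto
next
  case (Suc k)
  show ?case
    by (rule Ck_on_SucI[OF \<open>open S\<close>, where D = "\<lambda>x v. B (f x) (frechet_derivative g (at x) v) + B (frechet_derivative f (at x) v) (g x)"])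
      (auto intro!: bounded_bilinear.FDERIV[OF assms(2)] Ck_on_add[OF \<open>open S\<close>] Suc.IH
        Ck_on_SucD[OF Suc.prems(1)] Ck_on_SucD[OF Suc.prems(2)] Ck_on_Suc_imp[OF Suc.prems(1)] Ck_on_Suc_imp[OF Suc.prems(2)])
qed

text \<open>The variations used below feed \<gamma> with the second coordinate only. For this linear
  substitution every directional derivative has again the same shape, so the induction
  closes.\<close>

lemma Ck_on_comp_snd:
  fixes f :: "'b::real_normed_vector \<Rightarrow> 'c::real_normed_vector"
  shows "Ck_on k UNIV f \<Longrightarrow> Ck_on k UNIV (\<lambda>x::'a::real_normed_vector \<times> 'b. f (snd x))"
proof (induction k arbitrary: f)
  case 0
  then show ?case
    using continuous_on_compose2[OF _ continuous_on_snd[OF continuous_on_id]] by auto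
next
  case (Suc k)
  show ?case
  proof (rule Ck_on_SucI[where D = "\<lambda>x v. frechet_derivative f (at (snd x)) (snd v)"])
    show "((\<lambda>x. f (snd x)) has_derivative (\<lambda>v. frechet_derivative f (at (snd x)) (snd v))) (at x)"
      for x :: "'a \<times> 'b"
      by (rule has_derivative_compose[OF has_derivative_snd[OF has_derivative_ident]
            Ck_on_SucD(1)[OF Suc.prems]]) auto
    show "Ck_on k UNIV (\<lambda>x::'a \<times> 'b. frechet_derivative f (at (snd x)) (snd v))" for v :: "'a \<times> 'b"
      using Suc.IH[OF Ck_on_SucD(2)[OF Suc.prems]] .
  qed auto
qed

lemma Ck_on_subset: "Ck_on k S f \<Longrightarrow> T \<subseteq> S \<Longrightarrow> Ck_on k T f"
  by (induction k arbitrary: f) (auto intro: continuous_on_subset)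

subsection \<open>The matrix exponential\<close>

text \<open>Derivative of A^k in the direction X, that is, the sum of the A^i X A^(k-1-i). Since X
  and A need not commute, the recursion follows the product rule for A A^k.\<close>

primrec mat_power_deriv :: "real^'n::finite^'n \<Rightarrow> nat \<Rightarrow> real^'n^'n \<Rightarrow> real^'n^'n" where
  "mat_power_deriv A 0 X = 0"
| "mat_power_deriv A (Suc k) X = X ** ((**) A ^^ k) (mat 1) + A ** mat_power_deriv A k X"

lemma has_derivative_mat_power:
  "((\<lambda>A. ((**) A ^^ k) (mat 1)) has_derivative mat_power_deriv A k) (at A within S)"
proof (induction k)
  case 0
  then show ?case by (simp add: fun_eq_iff[symmetric] mat_power_deriv.simps(1)[abs_def])
next
  case (Suc k)
  show ?case
    using mat.FDERIV[OF has_derivative_ident Suc.IH] by (simp add: add.commute)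
qed

text \<open>With \<open>R \<ge> 1\<close> the exponent k - 1 of the derivative may be raised to
  \<open>k\<close>, which avoids a predecessor. The factor \<open>norm (mat 1)\<close> remains
  because the Frobenius norm of the identity is in general not 1.\<close>

lemma mat_power_bounds:
  fixes A X :: "real^'n::finite^'n"
  assumes "norm A \<le> R"
  shows "norm (((**) A ^^ k) (mat 1)) \<le> norm (mat 1 :: real^'n^'n) * R ^ k"
    and "R \<ge> 1 \<Longrightarrow> norm (mat_power_deriv A k X) \<le> norm (mat 1 :: real^'n^'n) * real k * R ^ k * norm X"
proof -
  let ?N = "norm (mat 1 :: real^'n^'n)"
  have R: "0 \<le> R" using assms norm_ge_zero order_trans by blast
  show pw: "norm (((**) A ^^ k) (mat 1)) \<le> ?N * R ^ k" for k
  proof (induction k)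
    case (Suc k)
    have "norm (((**) A ^^ Suc k) (mat 1)) \<le> norm A * norm (((**) A ^^ k) (mat 1))"
      using norm_matrix_mult by simp
    also have "\<dots> \<le> R * (?N * R ^ k)"
      using assms Suc R by (intro mult_mono) auto
    finally show ?case by (simp add: mult_ac)
  qed simp
  show "norm (mat_power_deriv A k X) \<le> ?N * real k * R ^ k * norm X" if "R \<ge> 1"
  proof (induction k)
    case (Suc k)
    have "norm (mat_power_deriv A (Suc k) X) \<le>
        norm X * norm (((**) A ^^ k) (mat 1)) + norm A * norm (mat_power_deriv A k X)"
      using norm_triangle_le[OF add_mono[OF norm_matrix_mult norm_matrix_mult]] by simp
    also have "\<dots> \<le> norm X * (?N * R ^ Suc k) + R * (?N * real k * R ^ k * norm X)"
      using assms R Suc power_increasing[OF le_SucI[OF order_refl] \<open>R \<ge> 1\<close>]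
      by (intro add_mono mult_mono order_trans[OF pw[of k]]) (auto intro!: mult_left_mono)
    also have "\<dots> = ?N * real (Suc k) * R ^ Suc k * norm X"
      by (simp add: algebra_simps)
    finally show ?case .
  qed simp
qed

text \<open>The power series is differentiated term by term on a ball around 0 that contains
  \<open>M\<close>; the tails of the derived series are dominated uniformly there.\<close>

lemma has_derivative_matrix_exp:
  fixes M :: "real^'n::finite^'n"
  shows "(\<lambda>k. (1 / fact k) *\<^sub>R (((**) M ^^ k) (mat 1))) sums matrix_exp M"
    and "(matrix_exp has_derivative (\<lambda>X. \<Sum>k. (1 / fact k) *\<^sub>R mat_power_deriv M k X)) (at M)"
proof -
  define N where "N = norm (mat 1 :: real^'n^'n)"
  note bounds = mat_power_bounds[where 'n = 'n, folded N_def]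
  have sm: "(\<lambda>k. (1 / fact k) *\<^sub>R (((**) A ^^ k) (mat 1))) sums matrix_exp A" for A :: "real^'n^'n"
  proof -
    define R where "R = max 1 (norm A)"
    have "summable (\<lambda>k. N * R ^ k / fact k)"
      using summable_mult[OF summable_exp[of R], of N] by (simp add: field_simps)
    then have "summable (\<lambda>k. (1 / fact k) *\<^sub>R (((**) A ^^ k) (mat 1)))"
      by (rule summable_comparison_test'[where N = 0])
        (auto intro!: divide_right_mono bounds(1) simp: R_def)
    then show ?thesis unfolding matrix_exp_def by (rule summable_sums)
  qed
  then show "(\<lambda>k. (1 / fact k) *\<^sub>R (((**) M ^^ k) (mat 1))) sums matrix_exp M" .
  \<comment> \<open>The increment 1 puts \<open>M\<close> in the open ball and makes
    \<open>R \<ge> 1\<close>.\<close>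
  define R where "R = norm M + 1"
  have R: "R \<ge> 1" by (simp add: R_def)
  \<comment> \<open>The factor k of the derived terms is absorbed by k < 2^k, hence
    \<open>2 * R\<close>; the majorant is still an exponential series.\<close>
  define c where "c k = N * (2 * R) ^ k / fact k" for k
  have "summable c" unfolding c_def
    using summable_mult[OF summable_exp[of "2 * R"], of N] by (simp add: field_simps)
  have c: "norm ((1 / fact k) *\<^sub>R mat_power_deriv A k X) \<le> c k * norm X" if "norm A \<le> R"
    for A X :: "real^'n^'n" and k
  proof -
    have "norm (mat_power_deriv A k X) \<le> N * real k * R ^ k * norm X" by (rule bounds(2)[OF that R])
    also have "\<dots> \<le> N * 2 ^ k * R ^ k * norm X"
      using R of_nat_less_two_power[of k, where 'a = real]
      by (intro mult_right_mono mult_left_mono) (auto simp: N_def)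
    finally show ?thesis
      by (simp add: c_def power_mult_distrib divide_right_mono mult_ac)
  qed
  have dsum: "summable (\<lambda>k. norm ((1 / fact k) *\<^sub>R mat_power_deriv A k X))" if "norm A \<le> R"
    for A X :: "real^'n^'n"
    by (rule summable_comparison_test'[where N = 0 and g = "\<lambda>k. c k * norm X"])
      (use c[OF that] in \<open>auto intro: summable_mult2 \<open>summable c\<close>\<close>)
  have "\<exists>g. \<forall>A::real^'n^'n\<in>ball 0 R. (\<lambda>k. (1 / fact k) *\<^sub>R (((**) A ^^ k) (mat 1))) sums (g A) \<and>
      (g has_derivative (\<lambda>X. \<Sum>k. (1 / fact k) *\<^sub>R mat_power_deriv A k X)) (at A within ball 0 R)"
  proof (rule has_derivative_series[where x = 0 and l = "matrix_exp 0"
        and f = "\<lambda>k A::real^'n^'n. (1 / fact k) *\<^sub>R (((**) A ^^ k) (mat 1))"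
        and f' = "\<lambda>k A X. (1 / fact k) *\<^sub>R mat_power_deriv A k X"])
    show "((\<lambda>A. (1 / fact k) *\<^sub>R (((**) A ^^ k) (mat 1))) has_derivative
        (\<lambda>X. (1 / fact k) *\<^sub>R mat_power_deriv A k X)) (at A within ball 0 R)" for k and A :: "real^'n^'n"
      by (intro has_derivative_scaleR_right has_derivative_mat_power)
    show "(0 :: real^'n^'n) \<in> ball 0 R" using R by simp
    show "(\<lambda>k. (1 / fact k) *\<^sub>R (((**) (0::real^'n^'n) ^^ k) (mat 1))) sums matrix_exp 0" by (rule sm)
    fix e :: real assume "e > 0"
    obtain n0 where n0: "\<And>n. n \<ge> n0 \<Longrightarrow> norm (\<Sum>i. c (i + n)) < e"
      using suminf_exist_split[OF \<open>e > 0\<close> \<open>summable c\<close>] by blast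
    have "norm ((\<Sum>k<n. (1 / fact k) *\<^sub>R mat_power_deriv A k X) - (\<Sum>k. (1 / fact k) *\<^sub>R mat_power_deriv A k X))
        \<le> e * norm X" if "n \<ge> n0" "A \<in> ball 0 R" for n and A X :: "real^'n^'n"
    proof -
      let ?f = "\<lambda>k. (1 / fact k) *\<^sub>R mat_power_deriv A k X"
      have A: "norm A \<le> R" using that by simp
      have sf: "summable ?f" using dsum[OF A] by (rule summable_norm_cancel)
      have "norm ((\<Sum>k<n. ?f k) - (\<Sum>k. ?f k)) = norm (\<Sum>k. ?f (k + n))"
        using suminf_minus_initial_segment[OF sf, of n] by (simp add: norm_minus_commute)
      also have "\<dots> \<le> (\<Sum>k. norm (?f (k + n)))"
        by (rule summable_norm) (rule summable_ignore_initial_segment[OF dsum[OF A]])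
      also have "\<dots> \<le> (\<Sum>k. c (k + n) * norm X)"
        by (intro suminf_le summable_mult2 summable_ignore_initial_segment[OF dsum[OF A]]
            summable_ignore_initial_segment[OF \<open>summable c\<close>] c[OF A])
      also have "\<dots> = (\<Sum>k. c (k + n)) * norm X"
        using \<open>summable c\<close> by (intro suminf_mult2[symmetric]) (simp add: summable_iff_shift)
      also have "\<dots> \<le> e * norm X"
        using n0[OF that(1)] by (intro mult_right_mono) auto
      finally show ?thesis .
    qed
    then show "\<forall>\<^sub>F n in sequentially. \<forall>A::real^'n^'n\<in>ball 0 R. \<forall>X. norm ((\<Sum>k<n. (1 / fact k) *\<^sub>R mat_power_deriv A k X)
        - (\<Sum>k. (1 / fact k) *\<^sub>R mat_power_deriv A k X)) \<le> e * norm X"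
      unfolding eventually_sequentially by blast
  qed auto
  then obtain g :: "real^'n^'n \<Rightarrow> real^'n^'n" where g: "\<And>A. A \<in> ball 0 R \<Longrightarrow> (\<lambda>k. (1 / fact k) *\<^sub>R (((**) A ^^ k) (mat 1))) sums (g A)"
    "\<And>A. A \<in> ball 0 R \<Longrightarrow> (g has_derivative (\<lambda>X. \<Sum>k. (1 / fact k) *\<^sub>R mat_power_deriv A k X)) (at A within ball 0 R)"
    by blast
  have M: "M \<in> ball 0 R" by (simp add: R_def)
  have "(g has_derivative (\<lambda>X. \<Sum>k. (1 / fact k) *\<^sub>R mat_power_deriv M k X)) (at M)"
    using g(2)[OF M] at_within_open[OF M] by simp
  then show "(matrix_exp has_derivative (\<lambda>X. \<Sum>k. (1 / fact k) *\<^sub>R mat_power_deriv M k X)) (at M)"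
    by (rule has_derivative_transform_within_open[OF _ open_ball M]) (use g(1) sm sums_unique2 in blast)
qed

lemma matrix_exp_0 [simp]: "matrix_exp 0 = mat 1"
proof -
  have "(\<lambda>k. (1 / fact k) *\<^sub>R (((**) (0::real^'a^'a) ^^ k) (mat 1))) sums mat 1"
    using sums_single[of 0 "\<lambda>_. mat 1 :: real^'a^'a"]
    by (rule sums_cong[THEN iffD1, rotated]) (auto simp: gr0_conv_Suc)
  then show ?thesis using has_derivative_matrix_exp(1) sums_unique2 by blast
qed

text \<open>The direction \<open>M\<close> commutes with \<open>t *\<^sub>R M\<close>, so all
  summands of the derivative of the power coincide. The factor \<open>Suc k\<close> later cancels
  against the factorial.\<close>

lemma mat_power_deriv_along:
  "mat_power_deriv (t *\<^sub>R M) (Suc k) M = real (Suc k) *\<^sub>R (M ** ((**) (t *\<^sub>R M) ^^ k) (mat 1))"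
proof (induction k)
  case (Suc k)
  let ?P = "((**) (t *\<^sub>R M) ^^ k) (mat 1)"
  have "mat_power_deriv (t *\<^sub>R M) (Suc (Suc k)) M =
      M ** (t *\<^sub>R M ** ?P) + (t *\<^sub>R M) ** (real (Suc k) *\<^sub>R (M ** ?P))"
    using Suc by simp
  also have "\<dots> = real (Suc (Suc k)) *\<^sub>R (M ** (t *\<^sub>R M ** ?P))"
  proof -
    have "real (Suc (Suc k)) * t = t + real (Suc k) * t" by (simp add: algebra_simps)
    then show ?thesis
      by (simp add: mat.scaleR_left mat.scaleR_right scaleR_add_left del: of_nat_Suc)
  qed
  finally show ?case by (simp del: of_nat_Suc mat_power_deriv.simps)
qed (simp add: mat.zero_right)

lemma matrix_exp_has_vector_derivative:
  "((\<lambda>t. matrix_exp (t *\<^sub>R M)) has_vector_derivative M ** matrix_exp (t *\<^sub>R M)) (at t)"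
proof -
  let ?d = "\<lambda>X. \<Sum>k. (1 / fact k) *\<^sub>R mat_power_deriv (t *\<^sub>R M) k X"
  let ?f = "\<lambda>k. (1 / fact k) *\<^sub>R mat_power_deriv (t *\<^sub>R M) k M"
  have "(\<lambda>k. M ** ((1 / fact k) *\<^sub>R ((**) (t *\<^sub>R M) ^^ k) (mat 1))) sums (M ** matrix_exp (t *\<^sub>R M))"
    by (rule bounded_linear.sums[OF mat.bounded_linear_right has_derivative_matrix_exp(1)])
  moreover have "M ** ((1 / fact k) *\<^sub>R ((**) (t *\<^sub>R M) ^^ k) (mat 1)) = ?f (Suc k)" for k
    unfolding mat_power_deriv_along by (simp add: mat.scaleR_right fact_Suc del: of_nat_Suc)
  \<comment> \<open>The term of index 0 vanishes, so the index shift does not change the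
    sum.\<close>
  ultimately have "?f sums (M ** matrix_exp (t *\<^sub>R M))"
    using sums_Suc_iff[of ?f "M ** matrix_exp (t *\<^sub>R M)"] by simp
  then have d: "?d M = M ** matrix_exp (t *\<^sub>R M)" by (simp add: sums_iff)
  have D: "(matrix_exp has_derivative ?d) (at (t *\<^sub>R M))" by (rule has_derivative_matrix_exp)
  have "((\<lambda>t. matrix_exp (t *\<^sub>R M)) has_derivative (\<lambda>h. ?d (h *\<^sub>R M))) (at t)"
    by (rule has_derivative_compose[where g = matrix_exp and g' = ?d and f = "\<lambda>t. t *\<^sub>R M", OF _ D]) (auto intro!: derivative_eq_intros)
  moreover have "?d (h *\<^sub>R M) = h *\<^sub>R ?d M" for h
    by (rule linear_scale[OF bounded_linear.linear[OF has_derivative_bounded_linear[OF D]]])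
  ultimately show ?thesis by (simp add: has_vector_derivative_def d)
qed

text \<open>Both sides solve Y' = M Y with Y(0) = X; for the right-hand side the hypothesis moves
  \<open>M\<close> past \<open>X\<close>.\<close>

lemma matrix_exp_commute: "matrix_exp (t *\<^sub>R M) ** X = X ** matrix_exp (t *\<^sub>R M)" if "M ** X = X ** M"
proof (rule linear_ode_unique[where L = "(**) M" and f = "\<lambda>t. matrix_exp (t *\<^sub>R M) ** X"])
  show "((\<lambda>t. matrix_exp (t *\<^sub>R M) ** X) has_vector_derivative M ** (matrix_exp (t *\<^sub>R M) ** X)) (at t)" for t
    by (auto intro!: derivative_eq_intros matrix_exp_has_vector_derivative simp: matrix_mul_assoc mat.zero_right)
  show "((\<lambda>t. X ** matrix_exp (t *\<^sub>R M)) has_vector_derivative M ** (X ** matrix_exp (t *\<^sub>R M))) (at t)" for t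
    by (auto intro!: derivative_eq_intros matrix_exp_has_vector_derivative simp: matrix_mul_assoc that mat.zero_left)
qed (auto simp: mat.bounded_linear_right)

text \<open>The derivative of E^T E is E^T (M^T + M) E = 0, so E^T E keeps its value at 0.\<close>

lemma orthogonal_matrix_exp_skew:
  assumes "skew M"
  shows "orthogonal_matrix (matrix_exp (t *\<^sub>R M))"
proof -
  let ?E = "\<lambda>t. matrix_exp (t *\<^sub>R M)"
  have M: "transpose M = - M" using assms by (simp add: skew_def)
  have "transpose (?E t) ** ?E t = mat 1"
  proof (rule linear_ode_unique[where L = "\<lambda>_. 0" and f = "\<lambda>t. transpose (?E t) ** ?E t" and g = "\<lambda>_. mat 1"])
    show "((\<lambda>t. transpose (?E t) ** ?E t) has_vector_derivative 0) (at t)" for t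
      by (auto intro!: derivative_eq_intros matrix_exp_has_vector_derivative
          simp: matrix_mul_assoc matrix_transpose_mul M mat.minus_left mat.minus_right)
  qed auto
  then show ?thesis by (simp add: orthogonal_matrix)
qed

text \<open>Along the fixed direction \<open>Z\<close> the derivative is u' Z times the same
  exponential, so the induction over \<open>k\<close> feeds on itself.\<close>

lemma Ck_on_matrix_exp:
  assumes "open S"
  shows "Ck_on k S u \<Longrightarrow> Ck_on k S (\<lambda>x. matrix_exp (u x *\<^sub>R Z))"
proof (induction k)
  case 0
  have "continuous_on UNIV (\<lambda>t. matrix_exp (t *\<^sub>R Z))"
    by (auto intro!: continuous_at_imp_continuous_on
        has_vector_derivative_continuous[OF matrix_exp_has_vector_derivative])
  from continuous_on_compose2[OF this] 0 show ?case by auto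
next
  case (Suc k)
  let ?D = "\<lambda>x. frechet_derivative u (at x)"
  show ?case
  proof (rule Ck_on_SucI[OF \<open>open S\<close>, where D = "\<lambda>x v. ?D x v *\<^sub>R (Z ** matrix_exp (u x *\<^sub>R Z))"])
    show "((\<lambda>x. matrix_exp (u x *\<^sub>R Z)) has_derivative (\<lambda>v. ?D x v *\<^sub>R (Z ** matrix_exp (u x *\<^sub>R Z)))) (at x)"
      if "x \<in> S" for x
      using has_derivative_compose[OF Ck_on_SucD(1)[OF Suc.prems that]
          matrix_exp_has_vector_derivative[unfolded has_vector_derivative_def, of Z "u x"]] by simp
    show "Ck_on k S (\<lambda>x. ?D x v *\<^sub>R (Z ** matrix_exp (u x *\<^sub>R Z)))" for v
      by (rule Ck_on_bilinear[OF \<open>open S\<close> bounded_bilinear_scaleR Ck_on_SucD(2)[OF Suc.prems]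
            Ck_on_bilinear[OF \<open>open S\<close> bounded_bilinear_matrix_mult Ck_on_const
              Suc.IH[OF Ck_on_Suc_imp[OF Suc.prems]]]])
  qed
qed

subsection \<open>The Stiefel manifold\<close>

lemma stack_nth [simp]: "stack A H $ Inl k = A $ k" "stack A H $ Inr l = H $ l"
  by (simp_all add: stack_def)

lemma vec_eq_iff_sum: "X = Y \<longleftrightarrow> (\<forall>k. X $ Inl k = Y $ Inl k) \<and> (\<forall>l. X $ Inr l = Y $ Inr l)"
  for X Y :: "'a^('p::finite + 'q::finite)"
  unfolding vec_eq_iff by (metis sum.exhaust)

lemma stack_surj: "stack (\<chi> k. Y $ Inl k) (\<chi> l. Y $ Inr l) = Y"
  by (simp add: vec_eq_iff_sum)

lemma stack_inject: "stack A H = stack B K \<longleftrightarrow> A = B \<and> H = K"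
  by (auto simp: vec_eq_iff_sum) (simp_all add: vec_eq_iff)

lemma stack_arith:
  "stack A H + stack B K = stack (A + B) (H + K)"
  "stack A H - stack B K = stack (A - B) (H - K)"
  "- stack A H = stack (- A) (- H)"
  "c *\<^sub>R stack A H = stack (c *\<^sub>R A) (c *\<^sub>R H)"
  "stack 0 0 = 0"
  by (simp_all add: vec_eq_iff_sum)

lemma stack_mult: "stack A H ** B = stack (A ** B) (H ** B)"
  by (simp add: vec_eq_iff_sum) (simp add: vec_eq_iff matrix_matrix_mult_def)

lemma block_mult_stack:
  "block A B C D ** stack X (Y :: real^'p::finite^'q::finite) = stack (A ** X + B ** Y) (C ** X + D ** Y)"
  by (simp add: vec_eq_iff_sum) (simp add: vec_eq_iff matrix_matrix_mult_def block_def sum_UNIV_sum)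

lemma transpose_block: "transpose (block A B C D) = block (transpose A) (transpose C) (transpose B) (transpose D)"
  by (simp add: vec_eq_iff_sum transpose_def block_def)

lemma block_arith:
  "- block A B C D = block (- A) (- B) (- C) (- D)"
  "c *\<^sub>R block A B C D = block (c *\<^sub>R A) (c *\<^sub>R B) (c *\<^sub>R C) (c *\<^sub>R D)"
  by (simp_all add: vec_eq_iff_sum block_def)

lemma transpose_stack_mult:
  "transpose (stack A H) ** stack B (K :: real^'p::finite^'q::finite) = transpose A ** B + transpose H ** K"
  by (simp add: vec_eq_iff matrix_matrix_mult_def transpose_def sum_UNIV_sum)

lemma orthogonal_matrix_cancel:
  fixes Q :: "real^'n::finite^'n"
  assumes "orthogonal_matrix Q"
  shows "transpose Q ** (Q ** X) = X" "Q ** (transpose Q ** X) = X"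
  using assms by (auto simp: matrix_mul_assoc orthogonal_matrix_def)

lemma orthogonal_matrix_gram:
  fixes Q :: "real^'n::finite^'n"
  assumes "orthogonal_matrix Q"
  shows "transpose (Q ** X) ** (Q ** Y) = transpose X ** Y"
proof -
  have "transpose (Q ** X) ** (Q ** Y) = transpose X ** (transpose Q ** (Q ** Y))"
    by (simp only: matrix_transpose_mul matrix_mul_assoc)
  then show ?thesis by (simp only: orthogonal_matrix_cancel(1)[OF assms])
qed

lemma gram_I_np: "transpose I_np ** (I_np :: real^'p::finite^('p + 'q::finite)) = mat 1"
  by (simp add: I_np_def transpose_stack_mult mat.zero_right)

text \<open>The columns of \<open>X\<close> are completed to an orthonormal basis.\<close>

lemma stiefel_completion:
  fixes X :: "real^'p::finite^('p + 'q::finite)"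
  shows "X \<in> stiefel \<longleftrightarrow> (\<exists>Q. orthogonal_matrix Q \<and> X = Q ** I_np)"
proof
  assume "X \<in> stiefel"
  then have "transpose X ** X = mat 1" by (simp add: stiefel_def)
  then have X: "column i X \<bullet> column j X = (if i = j then 1 else 0)" for i j
    by (simp add: matrix_mult_transpose_dot_column vec_eq_iff mat_def)
  define U where "U = range (\<lambda>i. column i X)"
  have inj: "inj (\<lambda>i. column i X)"
  proof (rule injI)
    fix i j assume "column i X = column j X"
    then show "i = j" using X[of i j] X[of i i] by (auto split: if_splits)
  qed
  have "pairwise orthogonal U" "0 \<notin> U"
    using X by (auto simp: U_def pairwise_def orthogonal_def split: if_splits)
      (metis inner_zero_left zero_neq_one)
  then have "independent U" by (rule pairwise_orthogonal_independent)
  then have dimU: "dim (span U) = CARD('p)"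
    using dim_eq_card_independent[of U] card_image[OF inj] by (simp add: U_def)
  define C where "C = {y. \<forall>x\<in>span U. orthogonal x y}"
  have "subspace C" unfolding C_def by (rule subspace_orthogonal_to_vectors)
  then obtain B where B: "B \<subseteq> C" "pairwise orthogonal B" "\<And>x. x \<in> B \<Longrightarrow> norm x = 1"
    and "independent B" "card B = dim C"
    by (rule orthonormal_basis_subspace) blast
  have "dim C + CARD('p) = CARD('p) + CARD('q)"
    using dim_subspace_orthogonal_to_vectors[of "span U" UNIV] dimU by (simp add: C_def)
  then have "card B = CARD('q)" using \<open>card B = dim C\<close> by simp
  then obtain b :: "'q \<Rightarrow> real^('p + 'q)" where b: "bij_betw b UNIV B"
    using finite_same_card_bij[of "UNIV :: 'q set" B] independent_imp_finite[OF \<open>independent B\<close>] by auto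
  have bb: "b l \<bullet> b m = (if l = m then 1 else 0)" for l m
  proof (cases "l = m")
    case True
    then show ?thesis using B(3)[of "b m"] b by (auto simp: bij_betw_def norm_eq_1)
  next
    case False
    then have "b l \<noteq> b m" using b by (auto simp: bij_betw_def inj_on_def)
    then show ?thesis using B(2) b False by (auto simp: pairwise_def orthogonal_def bij_betw_def)
  qed
  have Xb: "column i X \<bullet> b l = 0" for i l
  proof -
    have "b l \<in> C" using B(1) b by (auto simp: bij_betw_def)
    then show ?thesis by (auto simp: C_def orthogonal_def U_def span_base)
  qed
  define Q :: "real^('p + 'q)^('p + 'q)"
    where "Q = (\<chi> i j. case j of Inl k \<Rightarrow> X $ i $ k | Inr l \<Rightarrow> b l $ i)"
  have col: "column (Inl k) Q = column k X" "column (Inr l) Q = b l" for k l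
    by (simp_all add: Q_def column_def vec_eq_iff)
  have Xb': "b l \<bullet> column i X = 0" for i l
    using Xb[of i l] by (simp add: inner_commute)
  have "column i Q \<bullet> column j Q = (if i = j then 1 else 0)" for i j
    by (cases i; cases j) (simp_all add: col X bb Xb Xb')
  then have "transpose Q ** Q = mat 1"
    by (simp add: matrix_mult_transpose_dot_column vec_eq_iff mat_def)
  moreover have "Q ** I_np = X"
    by (simp add: vec_eq_iff matrix_matrix_mult_def I_np_def Q_def sum_UNIV_sum mat_def mult_delta_right)
  ultimately show "\<exists>Q. orthogonal_matrix Q \<and> X = Q ** I_np" by (auto simp: orthogonal_matrix)
next
  assume "\<exists>Q. orthogonal_matrix Q \<and> X = Q ** I_np"
  then show "X \<in> stiefel" by (auto simp: stiefel_def orthogonal_matrix_gram gram_I_np)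
qed

text \<open>The block A equals X^T v in every frame. This turns the existential over frames into a
  linear condition on v.\<close>

lemma stiefel_tangent_iff:
  assumes "orthogonal_matrix Q"
  shows "v \<in> stiefel_tangent (Q ** I_np) \<longleftrightarrow> skew (transpose (Q ** I_np) ** v)"
proof
  assume "v \<in> stiefel_tangent (Q ** I_np)"
  then obtain P A H where "orthogonal_matrix P" "Q ** I_np = P ** I_np" "skew A" "v = P ** stack A H"
    by (auto simp: stiefel_tangent_def)
  then show "skew (transpose (Q ** I_np) ** v)"
    by (simp add: orthogonal_matrix_gram transpose_I_np_stack)
next
  assume *: "skew (transpose (Q ** I_np) ** v)"
  define A where "A = (\<chi> k. (transpose Q ** v) $ Inl k)"
  define H where "H = (\<chi> l. (transpose Q ** v) $ Inr l)"
  have v: "v = Q ** stack A H"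
    using assms by (simp add: A_def H_def stack_surj orthogonal_matrix_cancel)
  then have "skew A"
    using * assms by (simp add: orthogonal_matrix_gram transpose_I_np_stack)
  then show "v \<in> stiefel_tangent (Q ** I_np)"
    using assms v by (auto simp: stiefel_tangent_def)
qed

text \<open>The Frobenius product gives both blocks weight 1, and the A block is X^T v; subtracting
  1 - \<beta> times its product leaves weight \<beta>. In this form the metric is polynomial in the
  point and can be differentiated along a variation.\<close>

lemma stiefel_metric_inner:
  assumes "X \<in> stiefel"
  shows "stiefel_metric \<beta> X v w = v \<bullet> w - (1 - \<beta>) * ((transpose X ** v) \<bullet> (transpose X ** w))"
proof -
  obtain Q where Q: "orthogonal_matrix Q" and X: "X = Q ** I_np"
    using assms stiefel_completion by blast
  have *: "y = Q ** stack (\<chi> k. (transpose Q ** y) $ Inl k) (\<chi> l. (transpose Q ** y) $ Inr l)" for y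
    using Q by (simp add: stack_surj orthogonal_matrix_cancel)
  obtain A H where v: "v = Q ** stack A H" using * by blast
  obtain B K where w: "w = Q ** stack B K" using * by blast
  have "stiefel_metric \<beta> X v w = \<beta> * (A \<bullet> B) + H \<bullet> K"
    unfolding X v w stiefel_metric_eq[OF Q] by (simp add: inner_matrix)
  also have "\<dots> = v \<bullet> w - (1 - \<beta>) * ((transpose X ** v) \<bullet> (transpose X ** w))"
    unfolding X v w orthogonal_matrix_gram[OF Q] transpose_I_np_stack inner_matrix_mult_left
      orthogonal_matrix_cancel(1)[OF Q]
    by (simp add: inner_vec_def[of "stack _ _"] sum_UNIV_sum inner_vec_def[of A B] inner_vec_def[of H K] algebra_simps)
  finally show ?thesis .
qed

subsection \<open>The first variation of the energy\<close>

lemma has_derivative_partial: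
  fixes f :: "real \<times> real \<Rightarrow> 'a::real_normed_vector"
  assumes "(f has_derivative D) (at (s, t))"
  shows "((\<lambda>s. f (s, t)) has_vector_derivative D (1, 0)) (at s)"
    and "((\<lambda>t. f (s, t)) has_vector_derivative D (0, 1)) (at t)"
proof -
  have lin: "linear D" using has_derivative_bounded_linear[OF assms] by (rule bounded_linear.linear)
  have s1: "((\<lambda>s. f (s, t)) has_derivative (\<lambda>h. D (h, 0))) (at s)"
    by (rule has_derivative_compose[where f = "\<lambda>s. (s, t)" and g = f, OF _ assms])
      (auto intro!: derivative_eq_intros)
  have s2: "(\<lambda>h. D (h, 0)) = (\<lambda>h. h *\<^sub>R D (1, 0))"
  proof
    show "D (h, 0) = h *\<^sub>R D (1, 0)" for h using linear_scale[OF lin, of h "(1, 0)"] by simp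
  qed
  show "((\<lambda>s. f (s, t)) has_vector_derivative D (1, 0)) (at s)"
    unfolding has_vector_derivative_def by (rule has_derivative_eq_rhs[OF s1 s2])
  have t1: "((\<lambda>t. f (s, t)) has_derivative (\<lambda>h. D (0, h))) (at t)"
    by (rule has_derivative_compose[where f = "\<lambda>t. (s, t)" and g = f, OF _ assms])
      (auto intro!: derivative_eq_intros)
  have t2: "(\<lambda>h. D (0, h)) = (\<lambda>h. h *\<^sub>R D (0, 1))"
  proof
    show "D (0, h) = h *\<^sub>R D (0, 1)" for h using linear_scale[OF lin, of h "(0, 1)"] by simp
  qed
  show "((\<lambda>t. f (s, t)) has_vector_derivative D (0, 1)) (at t)"
    unfolding has_vector_derivative_def by (rule has_derivative_eq_rhs[OF t1 t2])
qed

lemma leibniz_rule_strip: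
  fixes f fs :: "real \<Rightarrow> real \<Rightarrow> real"
  assumes "0 < \<epsilon>"
    and "\<And>s t. s \<in> {-\<epsilon><..<\<epsilon>} \<Longrightarrow> ((\<lambda>s. f s t) has_vector_derivative fs s t) (at s)"
    and "continuous_on ({-\<epsilon><..<\<epsilon>} \<times> UNIV) (\<lambda>x. fs (fst x) (snd x))"
    and "\<And>s. s \<in> {-\<epsilon><..<\<epsilon>} \<Longrightarrow> continuous_on UNIV (f s)"
  shows "((\<lambda>s. integral {a..b} (f s)) has_real_derivative integral {a..b} (fs 0)) (at 0)"
proof -
  let ?U = "{-\<epsilon><..<\<epsilon>}"
  have "((\<lambda>s. integral (cbox a b) (f s)) has_field_derivative integral (cbox a b) (fs 0)) (at 0 within ?U)"
  proof (rule leibniz_rule_field_derivative)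
    show "((\<lambda>s. f s t) has_real_derivative fs s t) (at s within ?U)" if "s \<in> ?U" for s t
      using assms(2)[OF that, of t]
      by (simp add: has_real_derivative_iff_has_vector_derivative has_vector_derivative_at_within)
    show "f s integrable_on cbox a b" if "s \<in> ?U" for s
      using assms(4)[OF that] by (intro integrable_continuous continuous_on_subset[OF assms(4)[OF that]]) auto
    show "continuous_on (?U \<times> cbox a b) (\<lambda>(s, t). fs s t)"
      using continuous_on_subset[OF assms(3), of "?U \<times> cbox a b"] by (auto simp: split_beta)
  qed (use \<open>0 < \<epsilon>\<close> in auto)
  then show ?thesis
    using at_within_open[of 0 ?U] \<open>0 < \<epsilon>\<close> by auto
qed

text \<open>The mixed partial derivative is removed by integrating by parts in \<open>t\<close> before
  differentiating in \<open>s\<close>, so that its symmetry is not needed.\<close>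

lemma stiefel_first_variation:
  fixes \<gamma> \<gamma>1 \<gamma>2 :: "real \<Rightarrow> real^'p::finite^('p + 'q::finite)" and \<beta> :: real
  defines "C \<equiv> \<lambda>t. transpose (\<gamma> t) ** \<gamma>1 t"
    and "C' \<equiv> \<lambda>t. transpose (\<gamma>1 t) ** \<gamma>1 t + transpose (\<gamma> t) ** \<gamma>2 t"
  assumes "a < b" "0 < \<epsilon>"
    and var: "proper_variation stiefel \<gamma> a b \<epsilon> \<Gamma>"
    and \<gamma>1: "\<And>t. (\<gamma> has_vector_derivative \<gamma>1 t) (at t)"
    and \<gamma>2: "\<And>t. (\<gamma>1 has_vector_derivative \<gamma>2 t) (at t)"
    and cont2: "continuous_on UNIV \<gamma>2"
  shows "((\<lambda>s. curve_energy (stiefel_metric \<beta>) (\<lambda>t. \<Gamma> (s, t)) a b) has_real_derivative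
      - integral {a..b} (\<lambda>t. (\<gamma>2 t - (1 - \<beta>) *\<^sub>R (2 *\<^sub>R (\<gamma>1 t ** C t) + \<gamma> t ** C' t)) \<bullet>
          frechet_derivative \<Gamma> (at (0, t)) (1, 0))) (at 0)"
proof -
  let ?U = "{-\<epsilon><..<\<epsilon>}"
  let ?S = "?U \<times> (UNIV :: real set)"
  have "open ?S" by (simp add: open_Times)
  have zero: "0 \<in> ?U" using \<open>0 < \<epsilon>\<close> by simp
  have \<Gamma>2: "Ck_on (Suc (Suc 0)) ?S \<Gamma>" and \<Gamma>M: "\<And>x. x \<in> ?S \<Longrightarrow> \<Gamma> x \<in> stiefel"
    and \<Gamma>0: "\<And>t. \<Gamma> (0, t) = \<gamma> t" and \<Gamma>ab: "\<And>s. s \<in> ?U \<Longrightarrow> \<Gamma> (s, a) = \<gamma> a \<and> \<Gamma> (s, b) = \<gamma> b"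
    using var by (auto simp: proper_variation_def smooth_on_def simp del: Ck_on.simps)
  define \<Gamma>s where "\<Gamma>s x = frechet_derivative \<Gamma> (at x) (1, 0)" for x
  define \<Gamma>t where "\<Gamma>t x = frechet_derivative \<Gamma> (at x) (0, 1)" for x
  define \<Gamma>ts where "\<Gamma>ts x = frechet_derivative \<Gamma>t (at x) (1, 0)" for x
  have \<Gamma>t1: "Ck_on (Suc 0) ?S \<Gamma>t"
    using Ck_on_SucD(2)[OF \<Gamma>2] by (simp only: \<Gamma>t_def[abs_def])
  have cont: "continuous_on ?S \<Gamma>" "continuous_on ?S \<Gamma>s" "continuous_on ?S \<Gamma>t" "continuous_on ?S \<Gamma>ts"
    using Ck_on_Suc_imp[OF Ck_on_Suc_imp[OF \<Gamma>2]] Ck_on_Suc_imp[OF Ck_on_SucD(2)[OF \<Gamma>2]]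
      Ck_on_Suc_imp[OF \<Gamma>t1] Ck_on_SucD(2)[OF \<Gamma>t1]
    by (simp_all add: \<Gamma>s_def[abs_def] \<Gamma>ts_def[abs_def])
  have ds: "((\<lambda>s. \<Gamma> (s, t)) has_vector_derivative \<Gamma>s (s, t)) (at s)"
    and dt: "((\<lambda>t. \<Gamma> (s, t)) has_vector_derivative \<Gamma>t (s, t)) (at t)"
    and dts: "((\<lambda>s. \<Gamma>t (s, t)) has_vector_derivative \<Gamma>ts (s, t)) (at s)" if "s \<in> ?U" for s t
    using that by (auto simp: \<Gamma>s_def \<Gamma>t_def[of "(s, t)"] \<Gamma>ts_def intro!: has_derivative_partial
        Ck_on_SucD(1)[OF \<Gamma>2] Ck_on_SucD(1)[OF \<Gamma>t1])
  have slice: "continuous_on UNIV (\<lambda>t. f (s, t))" if "continuous_on ?S f" "s \<in> ?U"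
    for f :: "real \<times> real \<Rightarrow> real^'p^('p + 'q)" and s
    by (rule continuous_on_compose2[OF that(1)]) (use that(2) in \<open>auto intro!: continuous_intros\<close>)
  have pull: "continuous_on ?S (\<lambda>x. f (snd x))" if "continuous_on UNIV f"
    for f :: "real \<Rightarrow> real^'p^('p + 'q)"
    by (rule continuous_on_compose2[OF that]) (auto intro!: continuous_intros)
  note mc = bounded_bilinear.continuous_on[OF bounded_bilinear_matrix_mult]
    bounded_linear.continuous_on[OF bounded_linear_transpose]
  note integ = integrable_continuous_interval[OF continuous_on_subset[OF _ subset_UNIV]]
  have \<Gamma>t0: "\<Gamma>t (0, t) = \<gamma>1 t" for t
    using vector_derivative_unique_at[OF dt[OF zero, of t]] \<gamma>1[of t] by (simp add: \<Gamma>0)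
  have cg: "continuous_on UNIV \<gamma>" "continuous_on UNIV \<gamma>1"
    using \<gamma>1 \<gamma>2 by (auto intro!: continuous_at_imp_continuous_on has_vector_derivative_continuous)
  define V where "V t = \<Gamma>s (0, t)" for t
  have cV: "continuous_on UNIV V" unfolding V_def using slice[OF cont(2) zero] .

  have dC: "(C has_vector_derivative C' t) (at t)" for t
    unfolding C_def C'_def by (auto intro!: derivative_eq_intros \<gamma>1 \<gamma>2)
  have skewC: "transpose (C t) = - C t" for t
  proof -
    have "((\<lambda>t. transpose (\<gamma> t) ** \<gamma> t) has_vector_derivative transpose (\<gamma> t) ** \<gamma>1 t + transpose (\<gamma>1 t) ** \<gamma> t) (at t)"
      by (intro derivative_intros \<gamma>1)
    moreover have "transpose (\<gamma> t) ** \<gamma> t = mat 1" for t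
      using \<Gamma>M[of "(0, t)"] zero by (simp add: \<Gamma>0 stiefel_def)
    ultimately have "transpose (\<gamma> t) ** \<gamma>1 t + transpose (\<gamma>1 t) ** \<gamma> t = 0"
      using vector_derivative_unique_at[OF has_vector_derivative_const] by fastforce
    then show ?thesis by (simp add: C_def matrix_transpose_mul eq_neg_iff_add_eq_0 add.commute)
  qed

  define e where "e s t = 1 / 2 * (\<Gamma>t (s, t) \<bullet> \<Gamma>t (s, t) - (1 - \<beta>) *
      ((transpose (\<Gamma> (s, t)) ** \<Gamma>t (s, t)) \<bullet> (transpose (\<Gamma> (s, t)) ** \<Gamma>t (s, t))))" for s t
  define es where "es s t = \<Gamma>t (s, t) \<bullet> \<Gamma>ts (s, t) - (1 - \<beta>) *
      ((transpose (\<Gamma> (s, t)) ** \<Gamma>t (s, t)) \<bullet>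
        (transpose (\<Gamma> (s, t)) ** \<Gamma>ts (s, t) + transpose (\<Gamma>s (s, t)) ** \<Gamma>t (s, t)))" for s t
  have E: "curve_energy (stiefel_metric \<beta>) (\<lambda>t. \<Gamma> (s, t)) a b = integral {a..b} (e s)" if "s \<in> ?U" for s
  proof -
    have "vector_derivative (\<lambda>t. \<Gamma> (s, t)) (at t) = \<Gamma>t (s, t)" for t
      using dt[OF that] by (rule vector_derivative_at)
    then show ?thesis
      using \<Gamma>M that by (simp add: curve_energy_def stiefel_metric_inner e_def[abs_def])
  qed
  have dE: "((\<lambda>s. integral {a..b} (e s)) has_real_derivative integral {a..b} (es 0)) (at 0)"
  proof (rule leibniz_rule_strip[OF \<open>0 < \<epsilon>\<close>])
    show "((\<lambda>s. e s t) has_vector_derivative es s t) (at s)" if "s \<in> ?U" for s t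
      unfolding e_def es_def
      by (rule has_vector_derivative_eq_rhs, (rule derivative_intros
            bounded_bilinear.has_vector_derivative[OF bounded_bilinear_inner] ds[OF that] dts[OF that])+)
        (simp add: inner_commute algebra_simps)
    show "continuous_on ?S (\<lambda>x. es (fst x) (snd x))"
      unfolding es_def prod.collapse by (intro continuous_intros mc cont)
    show "continuous_on UNIV (e s)" if "s \<in> ?U" for s
      unfolding e_def by (intro continuous_intros mc slice[OF _ that] cont)
  qed

  \<comment> \<open>The momentum: the derivative of the energy density with respect to the velocity.
    It is what pairs with the mixed derivative \<open>\<Gamma>ts\<close>.\<close>
  define P where "P t = \<gamma>1 t - (1 - \<beta>) *\<^sub>R (\<gamma> t ** C t)" for t
  define P' where "P' t = \<gamma>2 t - (1 - \<beta>) *\<^sub>R (\<gamma> t ** C' t + \<gamma>1 t ** C t)" for t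
  have dP: "(P has_vector_derivative P' t) (at t)" for t
    unfolding P_def[abs_def] P'_def by (auto intro!: derivative_eq_intros \<gamma>1 \<gamma>2 dC)
  have cP: "continuous_on UNIV P"
    using dP by (auto intro!: continuous_at_imp_continuous_on has_vector_derivative_continuous)
  have cP': "continuous_on UNIV P'"
    unfolding P'_def[abs_def] C'_def C_def by (intro continuous_intros mc cg cont2)
  have parts: "integral {a..b} (\<lambda>t. P t \<bullet> \<Gamma>ts (0, t)) = - integral {a..b} (\<lambda>t. P' t \<bullet> V t)"
  proof -
    have parts1: "((\<lambda>s. integral {a..b} (\<lambda>t. P t \<bullet> \<Gamma>t (s, t))) has_real_derivative
        integral {a..b} (\<lambda>t. P t \<bullet> \<Gamma>ts (0, t))) (at 0)"
    proof (rule leibniz_rule_strip[OF \<open>0 < \<epsilon>\<close>])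
      show "((\<lambda>s. P t \<bullet> \<Gamma>t (s, t)) has_vector_derivative P t \<bullet> \<Gamma>ts (s, t)) (at s)" if "s \<in> ?U" for s t
        by (rule bounded_linear.has_vector_derivative[OF bounded_linear_inner_right dts[OF that]])
      show "continuous_on ?S (\<lambda>x. P (snd x) \<bullet> \<Gamma>ts (fst x, snd x))"
        unfolding prod.collapse by (intro continuous_intros cont pull cP)
      show "continuous_on UNIV (\<lambda>t. P t \<bullet> \<Gamma>t (s, t))" if "s \<in> ?U" for s
        by (intro continuous_intros slice[OF _ that] cont cP)
    qed
    have parts2: "((\<lambda>s. (P b \<bullet> \<gamma> b - P a \<bullet> \<gamma> a) - integral {a..b} (\<lambda>t. P' t \<bullet> \<Gamma> (s, t))) has_real_derivative
        0 - integral {a..b} (\<lambda>t. P' t \<bullet> \<Gamma>s (0, t))) (at 0)"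
    proof (rule DERIV_diff[OF DERIV_const leibniz_rule_strip[OF \<open>0 < \<epsilon>\<close>]])
      show "((\<lambda>s. P' t \<bullet> \<Gamma> (s, t)) has_vector_derivative P' t \<bullet> \<Gamma>s (s, t)) (at s)" if "s \<in> ?U" for s t
        by (rule bounded_linear.has_vector_derivative[OF bounded_linear_inner_right ds[OF that]])
      show "continuous_on ?S (\<lambda>x. P' (snd x) \<bullet> \<Gamma>s (fst x, snd x))"
        unfolding prod.collapse by (intro continuous_intros cont pull cP')
      show "continuous_on UNIV (\<lambda>t. P' t \<bullet> \<Gamma> (s, t))" if "s \<in> ?U" for s
        by (intro continuous_intros slice[OF _ that] cont cP')
    qed
    \<comment> \<open>The boundary terms are the same for all \<open>s\<close> because the endpoints
      of the variation are fixed, so they drop out on differentiation in \<open>s\<close>.\<close>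
    have parts3: "(P b \<bullet> \<gamma> b - P a \<bullet> \<gamma> a) - integral {a..b} (\<lambda>t. P' t \<bullet> \<Gamma> (s, t)) =
        integral {a..b} (\<lambda>t. P t \<bullet> \<Gamma>t (s, t))" if "s \<in> ?U" for s
    proof -
      have "((\<lambda>t. P t \<bullet> \<Gamma>t (s, t) + P' t \<bullet> \<Gamma> (s, t)) has_integral P b \<bullet> \<Gamma> (s, b) - P a \<bullet> \<Gamma> (s, a)) {a..b}"
        using \<open>a < b\<close>
          bounded_bilinear.has_vector_derivative[OF bounded_bilinear_inner dP dt[OF that],
            THEN has_vector_derivative_at_within]
        by (intro fundamental_theorem_of_calculus) auto
      moreover have "(\<lambda>t. P t \<bullet> \<Gamma>t (s, t)) integrable_on {a..b}" "(\<lambda>t. P' t \<bullet> \<Gamma> (s, t)) integrable_on {a..b}"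
        by (intro integ continuous_intros slice[OF _ that] cont cP cP')+
      ultimately show ?thesis
        using \<Gamma>ab[OF that] integral_add[of "\<lambda>t. P t \<bullet> \<Gamma>t (s, t)" "{a..b}" "\<lambda>t. P' t \<bullet> \<Gamma> (s, t)"]
        by (simp add: integral_unique)
    qed
    have "((\<lambda>s. integral {a..b} (\<lambda>t. P t \<bullet> \<Gamma>t (s, t))) has_real_derivative
        0 - integral {a..b} (\<lambda>t. P' t \<bullet> \<Gamma>s (0, t))) (at 0)"
      by (rule has_field_derivative_transform_within_open[OF parts2 open_greaterThanLessThan zero parts3])
    from DERIV_unique[OF parts1 this] show ?thesis by (simp add: V_def)
  qed

  have "integral {a..b} (es 0) = integral {a..b} (\<lambda>t. P t \<bullet> \<Gamma>ts (0, t) + (1 - \<beta>) * ((\<gamma>1 t ** C t) \<bullet> V t))"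
  proof (rule integral_cong)
    fix t
    have Ct: "transpose (\<gamma> t) ** \<gamma>1 t = C t" by (simp add: C_def)
    have "C t \<bullet> (transpose (\<gamma> t) ** \<Gamma>ts (0, t)) = (\<gamma> t ** C t) \<bullet> \<Gamma>ts (0, t)"
      by (simp add: inner_matrix_mult_left)
    \<comment> \<open>Skewness of \<open>C\<close> turns the dependence of the metric on the base
      point into a second term in \<open>\<gamma>1 t ** C t\<close>.\<close>
    moreover have "C t \<bullet> (transpose (V t) ** \<gamma>1 t) = - ((\<gamma>1 t ** C t) \<bullet> V t)"
    proof -
      have "C t \<bullet> (transpose (V t) ** \<gamma>1 t) = transpose (C t) \<bullet> (transpose (\<gamma>1 t) ** V t)"
        using inner_transpose[of "C t" "transpose (V t) ** \<gamma>1 t"] by (simp add: matrix_transpose_mul)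
      also have "\<dots> = (\<gamma>1 t ** transpose (C t)) \<bullet> V t" by (simp add: inner_matrix_mult_left)
      finally show ?thesis by (simp add: skewC mat.minus_right)
    qed
    ultimately show "es 0 t = P t \<bullet> \<Gamma>ts (0, t) + (1 - \<beta>) * ((\<gamma>1 t ** C t) \<bullet> V t)"
      by (simp add: es_def P_def \<Gamma>t0 \<Gamma>0 Ct V_def[symmetric] inner_add_right inner_diff_left algebra_simps)
  qed
  also have "\<dots> = integral {a..b} (\<lambda>t. P t \<bullet> \<Gamma>ts (0, t)) + integral {a..b} (\<lambda>t. (1 - \<beta>) * ((\<gamma>1 t ** C t) \<bullet> V t))"
    unfolding C_def
    by (intro integral_add integ continuous_intros mc slice[OF cont(4) zero] cP cV cg)
  also have "\<dots> = - (integral {a..b} (\<lambda>t. P' t \<bullet> V t) - integral {a..b} (\<lambda>t. (1 - \<beta>) * ((\<gamma>1 t ** C t) \<bullet> V t)))"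
    by (simp add: parts)
  also have "integral {a..b} (\<lambda>t. P' t \<bullet> V t) - integral {a..b} (\<lambda>t. (1 - \<beta>) * ((\<gamma>1 t ** C t) \<bullet> V t)) =
      integral {a..b} (\<lambda>t. P' t \<bullet> V t - (1 - \<beta>) * ((\<gamma>1 t ** C t) \<bullet> V t))"
    unfolding C_def
    by (intro integral_diff[symmetric] integ continuous_intros mc cP' cV cg)
  \<comment> \<open>One copy of \<open>\<gamma>1 t ** C t\<close> comes from \<open>P'\<close> and
    one from the variation of the base point, whence the factor 2.\<close>
  also have "(\<lambda>t. P' t \<bullet> V t - (1 - \<beta>) * ((\<gamma>1 t ** C t) \<bullet> V t)) =
      (\<lambda>t. (\<gamma>2 t - (1 - \<beta>) *\<^sub>R (2 *\<^sub>R (\<gamma>1 t ** C t) + \<gamma> t ** C' t)) \<bullet> V t)"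
    by (simp add: fun_eq_iff P'_def inner_diff_left inner_add_left algebra_simps)
  finally have "integral {a..b} (es 0) = - integral {a..b}
      (\<lambda>t. (\<gamma>2 t - (1 - \<beta>) *\<^sub>R (2 *\<^sub>R (\<gamma>1 t ** C t) + \<gamma> t ** C' t)) \<bullet> V t)" .
  then show ?thesis
    using has_field_derivative_transform_within_open[OF dE open_greaterThanLessThan zero E[symmetric]]
    by (simp only: V_def \<Gamma>s_def)
qed

subsection \<open>Geodesics\<close>

lemmas mat_simps = mat.add_left mat.add_right mat.diff_left mat.diff_right mat.minus_left mat.minus_right
  mat.scaleR_left mat.scaleR_right mat.zero_left mat.zero_right matrix_mul_assoc matrix_transpose_mul transpose_simps

text \<open>Differentiation of X^T X = I. The open set \<open>U\<close> lets it serve both the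
  velocity of a curve and the variation field, where the parameter is confined to an
  interval.\<close>

lemma stiefel_curve_skew:
  fixes c :: "real \<Rightarrow> real^'p::finite^('p + 'q::finite)"
  assumes "open U" "s \<in> U" "\<And>s. s \<in> U \<Longrightarrow> c s \<in> stiefel" "(c has_vector_derivative v) (at s)"
  shows "skew (transpose (c s) ** v)"
proof -
  have "((\<lambda>s. transpose (c s) ** c s) has_vector_derivative transpose (c s) ** v + transpose v ** c s) (at s)"
    by (intro derivative_intros assms)
  moreover have "((\<lambda>s. transpose (c s) ** c s) has_vector_derivative 0) (at s)"
    using assms(3) by (intro has_vector_derivative_transform_within_open[OF has_vector_derivative_const assms(1,2)])
      (simp add: stiefel_def)
  ultimately have "transpose (c s) ** v + transpose v ** c s = 0"
    by (rule vector_derivative_unique_at)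
  then show ?thesis by (simp add: skew_def matrix_transpose_mul eq_neg_iff_add_eq_0 add.commute)
qed

lemma inner_symmetric_skew:
  assumes "transpose S = S" "skew K"
  shows "S \<bullet> K = 0"
proof -
  have "S \<bullet> K = transpose S \<bullet> transpose K" by simp
  also have "\<dots> = - (S \<bullet> K)" using assms by (simp add: skew_def)
  finally show ?thesis by simp
qed

text \<open>The matrices X S with S symmetric are Frobenius orthogonal to the tangent space at X. If
  the Euler-Lagrange expression has this form, it pairs to zero with every variation field.\<close>

lemma stiefel_geodesicI:
  fixes \<gamma> \<gamma>1 \<gamma>2 :: "real \<Rightarrow> real^'p::finite^('p + 'q::finite)" and \<beta> :: real
  assumes "smooth_on UNIV \<gamma>" "range \<gamma> \<subseteq> stiefel"
    and \<gamma>1: "\<And>t. (\<gamma> has_vector_derivative \<gamma>1 t) (at t)"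
    and \<gamma>2: "\<And>t. (\<gamma>1 has_vector_derivative \<gamma>2 t) (at t)"
    and cont2: "continuous_on UNIV \<gamma>2"
    and sym: "\<And>t. transpose (S t) = S t"
    and normal: "\<And>t. \<gamma>2 t - (1 - \<beta>) *\<^sub>R (2 *\<^sub>R (\<gamma>1 t ** (transpose (\<gamma> t) ** \<gamma>1 t)) +
      \<gamma> t ** (transpose (\<gamma>1 t) ** \<gamma>1 t + transpose (\<gamma> t) ** \<gamma>2 t)) = \<gamma> t ** S t"
  shows "geodesic stiefel (stiefel_metric \<beta>) \<gamma>"
  unfolding geodesic_def
proof (intro conjI allI impI assms(1,2))
  fix a b \<epsilon> :: real and \<Gamma> assume "a < b" "0 < \<epsilon>" and var: "proper_variation stiefel \<gamma> a b \<epsilon> \<Gamma>"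
  let ?U = "{-\<epsilon><..<\<epsilon>}"
  have "(\<gamma> t ** S t) \<bullet> frechet_derivative \<Gamma> (at (0, t)) (1, 0) = 0" for t
  proof -
    let ?V = "frechet_derivative \<Gamma> (at (0, t)) (1, 0)"
    have "Ck_on (Suc 0) (?U \<times> UNIV) \<Gamma>"
      using var by (auto simp: proper_variation_def smooth_on_def simp del: Ck_on.simps)
    then have "((\<lambda>s. \<Gamma> (s, t)) has_vector_derivative ?V) (at 0)"
      using \<open>0 < \<epsilon>\<close> by (intro has_derivative_partial Ck_on_SucD(1)[where k = 0 and S = "?U \<times> UNIV"]) (auto simp del: Ck_on.simps)
    then have "skew (transpose (\<Gamma> (0, t)) ** ?V)"
      using var \<open>0 < \<epsilon>\<close> by (intro stiefel_curve_skew[of ?U 0 "\<lambda>s. \<Gamma> (s, t)"]) (auto simp: proper_variation_def)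
    then have "skew (transpose (\<gamma> t) ** ?V)"
      using var by (simp add: proper_variation_def)
    then show ?thesis
      using inner_symmetric_skew[OF sym] by (simp add: inner_matrix_mult_left)
  qed
  then show "((\<lambda>s. curve_energy (stiefel_metric \<beta>) (\<lambda>t. \<Gamma> (s, t)) a b) has_real_derivative 0) (at 0)"
    using stiefel_first_variation[OF \<open>a < b\<close> \<open>0 < \<epsilon>\<close> var \<gamma>1 \<gamma>2 cont2, of \<beta>] by (simp add: normal)
qed

section \<open>From criticality of the energy to the geodesic equation\<close>

lemma orthogonal_mult_stiefel:
  "orthogonal_matrix P \<Longrightarrow> X \<in> stiefel \<Longrightarrow> P ** X \<in> stiefel"
  by (simp add: stiefel_def orthogonal_matrix_gram)

text \<open>Left multiplication by rotations keeps a curve on the manifold; the cutoff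
  \<open>(t - a) * (b - t)\<close> fixes the endpoints.\<close>

lemma rotation_variation:
  fixes \<gamma> :: "real \<Rightarrow> real^'p::finite^('p + 'q::finite)" and a b :: real
  assumes "smooth_on UNIV \<gamma>" "range \<gamma> \<subseteq> stiefel" "skew Z"
  defines "\<Gamma> \<equiv> \<lambda>x. matrix_exp ((fst x * ((snd x - a) * (b - snd x))) *\<^sub>R Z) ** \<gamma> (snd x)"
  shows "proper_variation stiefel \<gamma> a b \<epsilon> \<Gamma>"
    and "frechet_derivative \<Gamma> (at (0, t)) (1, 0) = ((t - a) * (b - t)) *\<^sub>R (Z ** \<gamma> t)"
proof -
  have prod: "Ck_on k UNIV (\<lambda>x. f x * g x)" if "Ck_on k UNIV f" "Ck_on k UNIV g"
    for f g :: "real \<times> real \<Rightarrow> real" and k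
    using Ck_on_bilinear[OF open_UNIV bounded_bilinear_mult that] .
  have "Ck_on k UNIV (\<lambda>x :: real \<times> real. fst x * ((snd x + - a) * (b + - snd x)))" for k
    by (intro prod Ck_on_add Ck_on_const Ck_on_linear bounded_linear_fst bounded_linear_snd
        bounded_linear_minus open_UNIV)
  then have Ck: "Ck_on k UNIV \<Gamma>" for k
    unfolding \<Gamma>_def using assms(1)
    by (intro Ck_on_bilinear[OF open_UNIV bounded_bilinear_matrix_mult] Ck_on_matrix_exp Ck_on_comp_snd open_UNIV)
      (simp_all add: smooth_on_def)
  then show "proper_variation stiefel \<gamma> a b \<epsilon> \<Gamma>"
    using assms(2) orthogonal_mult_stiefel[OF orthogonal_matrix_exp_skew[OF \<open>skew Z\<close>]] Ck_on_subset[OF Ck subset_UNIV]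
    by (auto simp: proper_variation_def smooth_on_def \<Gamma>_def)
  have "((\<lambda>s. \<Gamma> (s, t)) has_vector_derivative frechet_derivative \<Gamma> (at (0, t)) (1, 0)) (at 0)"
    by (intro has_derivative_partial Ck_on_SucD(1)[OF Ck[of "Suc 0"]]) simp
  moreover have "((\<lambda>s. \<Gamma> (s, t)) has_vector_derivative ((t - a) * (b - t)) *\<^sub>R (Z ** \<gamma> t)) (at 0)"
    using matrix_exp_has_vector_derivative[of "((t - a) * (b - t)) *\<^sub>R Z" 0]
    unfolding \<Gamma>_def by (auto intro!: derivative_eq_intros simp: mat_simps)
  ultimately show "frechet_derivative \<Gamma> (at (0, t)) (1, 0) = ((t - a) * (b - t)) *\<^sub>R (Z ** \<gamma> t)"
    by (rule vector_derivative_unique_at)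
qed

text \<open>The interval is arbitrary, so localization comes from shrinking it around
  \<open>t\<close>. The polynomial weight is positive inside, and a continuous nonnegative integrand
  with vanishing integral is zero.\<close>

lemma fundamental_lemma_variations:
  fixes h :: "real \<Rightarrow> real"
  assumes cont: "continuous_on UNIV h"
    and zero: "\<And>a b. a < b \<Longrightarrow> integral {a..b} (\<lambda>t. (t - a) * (b - t) * h t) = 0"
  shows "h t = 0"
proof -
  have False if cont: "continuous_on UNIV h" and "h t > 0"
    and zero: "\<And>a b. a < b \<Longrightarrow> integral {a..b} (\<lambda>t. (t - a) * (b - t) * h t) = 0" for h :: "real \<Rightarrow> real"
  proof -
    have "isCont h t" using cont by (simp add: continuous_on_eq_continuous_at)
    then obtain d where "d > 0" and d: "\<And>x. \<bar>x - t\<bar> < d \<Longrightarrow> \<bar>h x - h t\<bar> < h t"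
      using \<open>h t > 0\<close> by (auto simp: continuous_at_eps_delta dist_real_def)
    \<comment> \<open>Half of \<open>d\<close> keeps the closed interval inside the region where
      \<open>h\<close> is positive, and \<open>t\<close> is its midpoint, where the weight does not
      vanish.\<close>
    define a b where "a = t - d / 2" and "b = t + d / 2"
    have "a < b" using \<open>d > 0\<close> by (simp add: a_def b_def)
    have "0 \<le> (x - a) * (b - x) * h x" if "x \<in> {a..b}" for x
    proof -
      have "h x > 0" using d[of x] that \<open>d > 0\<close> by (auto simp: a_def b_def abs_less_iff)
      then show ?thesis using that by simp
    qed
    moreover have "continuous_on {a..b} (\<lambda>x. (x - a) * (b - x) * h x)"
      by (intro continuous_intros continuous_on_subset[OF cont]) auto
    ultimately have "\<forall>x\<in>{a..b}. (x - a) * (b - x) * h x = 0"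
      using integral_eq_0_iff[of a b "\<lambda>x. (x - a) * (b - x) * h x"] zero[OF \<open>a < b\<close>] \<open>a < b\<close>
      by blast
    moreover have "t \<in> {a..b}" using \<open>d > 0\<close> by (simp add: a_def b_def)
    ultimately have "(t - a) * (b - t) * h t = 0" by blast
    then show False using \<open>h t > 0\<close> \<open>d > 0\<close> by (simp add: a_def b_def)
  qed
  from this[of h] this[of "\<lambda>t. - h t"] show ?thesis
    using cont zero by (cases "h t" "0 :: real" rule: linorder_cases) (auto intro: continuous_intros)
qed

lemma smooth_curve_derivatives:
  assumes "smooth_on UNIV \<gamma>"
  obtains \<gamma>1 \<gamma>2 :: "real \<Rightarrow> 'a::real_normed_vector"
  where "\<And>t. (\<gamma> has_vector_derivative \<gamma>1 t) (at t)" "\<And>t. (\<gamma>1 has_vector_derivative \<gamma>2 t) (at t)"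
    "continuous_on UNIV \<gamma>2"
proof -
  have *: "(f has_vector_derivative frechet_derivative f (at t) 1) (at t)" if "Ck_on (Suc k) UNIV f"
    for f :: "real \<Rightarrow> 'a" and k t
    using that frechet_derivative_eq_vector_derivative[of f t]
    by (simp add: vector_derivative_works[symmetric])
  define \<gamma>1 where "\<gamma>1 t = frechet_derivative \<gamma> (at t) 1" for t
  have \<gamma>: "Ck_on (Suc (Suc 0)) UNIV \<gamma>" using assms by (simp add: smooth_on_def del: Ck_on.simps)
  then have \<gamma>1: "Ck_on (Suc 0) UNIV \<gamma>1" unfolding \<gamma>1_def by (rule Ck_on_SucD)
  show ?thesis
    using that[of \<gamma>1 "\<lambda>t. frechet_derivative \<gamma>1 (at t) 1"] *[OF \<gamma>] *[OF \<gamma>1] Ck_on_SucD(2)[OF \<gamma>1, of 1]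
    by (simp add: \<gamma>1_def)
qed

text \<open>Testing with \<open>Z\<close> the skew part of \<open>W \<gamma>\<^sup>T\<close> shows that this matrix is symmetric.\<close>

lemma stiefel_geodesic_normal:
  fixes \<gamma> \<gamma>1 \<gamma>2 :: "real \<Rightarrow> real^'p::finite^('p + 'q::finite)" and \<beta> :: real
  assumes "geodesic stiefel (stiefel_metric \<beta>) \<gamma>"
    and \<gamma>1: "\<And>t. (\<gamma> has_vector_derivative \<gamma>1 t) (at t)"
    and \<gamma>2: "\<And>t. (\<gamma>1 has_vector_derivative \<gamma>2 t) (at t)"
    and cont2: "continuous_on UNIV \<gamma>2"
  defines "W \<equiv> \<lambda>t. \<gamma>2 t - (1 - \<beta>) *\<^sub>R (2 *\<^sub>R (\<gamma>1 t ** (transpose (\<gamma> t) ** \<gamma>1 t)) +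
      \<gamma> t ** (transpose (\<gamma>1 t) ** \<gamma>1 t + transpose (\<gamma> t) ** \<gamma>2 t))"
  shows "W t = \<gamma> t ** (transpose (\<gamma> t) ** W t)" "transpose (transpose (\<gamma> t) ** W t) = transpose (\<gamma> t) ** W t"
proof -
  have smooth: "smooth_on UNIV \<gamma>" and range: "range \<gamma> \<subseteq> stiefel"
    and crit: "\<And>a b \<epsilon> \<Gamma>. a < b \<Longrightarrow> 0 < \<epsilon> \<Longrightarrow> proper_variation stiefel \<gamma> a b \<epsilon> \<Gamma> \<Longrightarrow>
      ((\<lambda>s. curve_energy (stiefel_metric \<beta>) (\<lambda>t. \<Gamma> (s, t)) a b) has_real_derivative 0) (at 0)"
    using assms(1) by (auto simp: geodesic_def)
  have cg: "continuous_on UNIV \<gamma>" "continuous_on UNIV \<gamma>1"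
    using \<gamma>1 \<gamma>2 by (auto intro!: continuous_at_imp_continuous_on has_vector_derivative_continuous)
  have cW: "continuous_on UNIV W" unfolding W_def
    by (intro continuous_intros cg cont2 bounded_bilinear.continuous_on[OF bounded_bilinear_matrix_mult]
        bounded_linear.continuous_on[OF bounded_linear_transpose])
  have ortho: "W t \<bullet> (Z ** \<gamma> t) = 0" if "skew Z" for Z
  proof (rule fundamental_lemma_variations[where h = "\<lambda>t. W t \<bullet> (Z ** \<gamma> t)"])
    show "continuous_on UNIV (\<lambda>t. W t \<bullet> (Z ** \<gamma> t))"
      by (intro continuous_intros cW cg bounded_bilinear.continuous_on[OF bounded_bilinear_matrix_mult])
    fix a b :: real assume "a < b"
    note var = rotation_variation[OF smooth range that, of a b]
    have "- integral {a..b} (\<lambda>t. W t \<bullet> (((t - a) * (b - t)) *\<^sub>R (Z ** \<gamma> t))) = 0"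
      using DERIV_unique[OF stiefel_first_variation[OF \<open>a < b\<close> zero_less_one var(1) \<gamma>1 \<gamma>2 cont2, of \<beta>]
        crit[OF \<open>a < b\<close> zero_less_one var(1)]] unfolding var(2) W_def .
    then show "integral {a..b} (\<lambda>t. (t - a) * (b - t) * (W t \<bullet> (Z ** \<gamma> t))) = 0" by simp
  qed
  define N where "N = W t ** transpose (\<gamma> t)"
  have N: "N \<bullet> Z = 0" if "skew Z" for Z
    using ortho[OF that] inner_matrix_mult_right[of Z "\<gamma> t" "W t"]
    by (simp add: N_def inner_matrix_mult_right inner_commute)
  have "N \<bullet> (N - transpose N) = 0" by (rule N) (simp add: skew_def transpose_simps)
  moreover have "transpose N \<bullet> (N - transpose N) = N \<bullet> (transpose N - N)"
    using inner_transpose[of N "transpose N - N"] by (simp add: transpose_simps)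
  moreover have "N \<bullet> (transpose N - N) = 0" by (rule N) (simp add: skew_def transpose_simps)
  ultimately have "(N - transpose N) \<bullet> (N - transpose N) = 0" by (simp add: inner_diff_left)
  then have "N = transpose N" by simp
  then have sym: "W t ** transpose (\<gamma> t) = \<gamma> t ** transpose (W t)"
    by (simp add: N_def matrix_transpose_mul)
  have \<gamma>\<gamma>: "transpose (\<gamma> t) ** \<gamma> t = mat 1" using range by (auto simp: stiefel_def)
  \<comment> \<open>Symmetry of W \<gamma>^T moves \<gamma> to the front: \<open>W t\<close> has no
    component outside the column space of \<open>\<gamma> t\<close>.\<close>
  have "W t = W t ** (transpose (\<gamma> t) ** \<gamma> t)" by (simp add: \<gamma>\<gamma>)
  also have "\<dots> = \<gamma> t ** (transpose (W t) ** \<gamma> t)" by (simp add: matrix_mul_assoc sym)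
  finally have W: "W t = \<gamma> t ** (transpose (W t) ** \<gamma> t)" .
  have S: "transpose (\<gamma> t) ** W t = transpose (W t) ** \<gamma> t"
    by (subst W) (simp add: matrix_mul_assoc \<gamma>\<gamma>)
  show "W t = \<gamma> t ** (transpose (\<gamma> t) ** W t)" unfolding S by (rule W)
  show "transpose (transpose (\<gamma> t) ** W t) = transpose (\<gamma> t) ** W t"
    unfolding S by (simp add: matrix_transpose_mul S)
qed

text \<open>The matrix \<gamma>^T W is symmetric, and \<beta> D' is its only skew summand, the
  square of a skew matrix being symmetric. As \<beta> \<noteq> 0, D' = 0, so D = \<gamma>^T
  \<gamma>' keeps its initial value \<open>C\<close>, which then replaces it in the Euler-Lagrange
  equation.\<close>

lemma stiefel_geodesic_equation:
  fixes \<gamma> \<gamma>1 \<gamma>2 :: "real \<Rightarrow> real^'p::finite^('p + 'q::finite)" and \<beta> :: real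
  assumes "\<beta> \<noteq> 0" and geo: "geodesic stiefel (stiefel_metric \<beta>) \<gamma>"
    and \<gamma>1: "\<And>t. (\<gamma> has_vector_derivative \<gamma>1 t) (at t)"
    and \<gamma>2: "\<And>t. (\<gamma>1 has_vector_derivative \<gamma>2 t) (at t)"
    and cont2: "continuous_on UNIV \<gamma>2"
  defines "C \<equiv> transpose (\<gamma> 0) ** \<gamma>1 0"
  shows "\<gamma>2 t = (2 * (1 - \<beta>)) *\<^sub>R (\<gamma>1 t ** C) -
      \<gamma> t ** (transpose (\<gamma>1 t) ** \<gamma>1 t + (2 * (1 - \<beta>)) *\<^sub>R (C ** C))"
proof -
  define D where "D t = transpose (\<gamma> t) ** \<gamma>1 t" for t
  define D' where "D' t = transpose (\<gamma>1 t) ** \<gamma>1 t + transpose (\<gamma> t) ** \<gamma>2 t" for t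
  define W where "W t = \<gamma>2 t - (1 - \<beta>) *\<^sub>R (2 *\<^sub>R (\<gamma>1 t ** D t) + \<gamma> t ** D' t)" for t
  note normal = stiefel_geodesic_normal[OF geo \<gamma>1 \<gamma>2 cont2, folded D_def D'_def, folded W_def]
  have range: "\<gamma> t \<in> stiefel" for t using geo by (auto simp: geodesic_def)
  then have \<gamma>\<gamma>: "transpose (\<gamma> t) ** \<gamma> t = mat 1" for t by (simp add: stiefel_def)
  have dD: "(D has_vector_derivative D' t) (at t)" for t
    unfolding D_def D'_def by (auto intro!: derivative_eq_intros \<gamma>1 \<gamma>2)
  have skewD: "transpose (D t) = - D t" for t
    using stiefel_curve_skew[OF open_UNIV UNIV_I range \<gamma>1, of t] by (simp add: skew_def D_def)
  have skewD': "transpose (D' t) = - D' t" for t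
  proof -
    have "((\<lambda>t. transpose (D t)) has_vector_derivative transpose (D' t)) (at t)"
      by (intro derivative_intros dD)
    moreover have "((\<lambda>t. - D t) has_vector_derivative - D' t) (at t)"
      by (intro derivative_intros dD)
    ultimately show ?thesis unfolding skewD by (rule vector_derivative_unique_at)
  qed
  have GW: "transpose (\<gamma> t) ** W t = \<beta> *\<^sub>R D' t - transpose (\<gamma>1 t) ** \<gamma>1 t - (2 * (1 - \<beta>)) *\<^sub>R (D t ** D t)" for t
  proof -
    have "transpose (\<gamma> t) ** W t = transpose (\<gamma> t) ** \<gamma>2 t -
        (1 - \<beta>) *\<^sub>R (2 *\<^sub>R ((transpose (\<gamma> t) ** \<gamma>1 t) ** D t) + (transpose (\<gamma> t) ** \<gamma> t) ** D' t)"
      by (simp add: W_def mat_simps)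
    also have "\<dots> = (D' t - transpose (\<gamma>1 t) ** \<gamma>1 t) - (1 - \<beta>) *\<^sub>R (2 *\<^sub>R (D t ** D t) + D' t)"
      by (simp add: \<gamma>\<gamma> D_def D'_def)
    also have "\<dots> = \<beta> *\<^sub>R D' t - transpose (\<gamma>1 t) ** \<gamma>1 t - (2 * (1 - \<beta>)) *\<^sub>R (D t ** D t)"
      by (simp add: algebra_simps)
    finally show ?thesis .
  qed
  have D'0: "D' t = 0" for t
  proof -
    have "transpose (transpose (\<gamma> t) ** W t) = transpose (\<gamma> t) ** W t" by (rule normal(2))
    then have "- (\<beta> *\<^sub>R D' t) = \<beta> *\<^sub>R D' t"
      unfolding GW by (simp add: mat_simps skewD skewD')
    then have "\<beta> *\<^sub>R D' t + \<beta> *\<^sub>R D' t = 0" by (metis add.left_inverse)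
    then have "(\<beta> + \<beta>) *\<^sub>R D' t = 0" by (simp only: scaleR_add_left)
    then show ?thesis using \<open>\<beta> \<noteq> 0\<close> by simp
  qed
  have D: "D t = C" for t
    using linear_ode_unique[OF bounded_linear_zero, of D "\<lambda>_. C"] dD D'0 by (simp add: C_def D_def)
  have "W t = \<gamma> t ** (- (transpose (\<gamma>1 t) ** \<gamma>1 t) - (2 * (1 - \<beta>)) *\<^sub>R (C ** C))"
    using normal(1)[of t] unfolding GW by (simp add: D D'0)
  moreover have "\<gamma>2 t = W t + (2 * (1 - \<beta>)) *\<^sub>R (\<gamma>1 t ** C)"
    by (simp add: W_def D D'0 mat.zero_right)
  ultimately show ?thesis by (simp add: mat.add_right mat.diff_right mat.minus_right)
qed

text \<open>The right-hand side of the geodesic equation is cubic, hence not globally Lipschitz. But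
  two given solutions are bounded on the compact interval up to \<open>t\<close>, and there their
  difference satisfies a linear bound. The matrix C is determined by x and v, so both solutions
  share it.\<close>

lemma stiefel_geodesic_unique:
  fixes \<gamma> \<delta> :: "real \<Rightarrow> real^'p::finite^('p + 'q::finite)"
  assumes "\<beta> \<noteq> 0" and geo: "geodesic_from stiefel (stiefel_metric \<beta>) x v \<gamma>" "geodesic_from stiefel (stiefel_metric \<beta>) x v \<delta>"
  shows "\<gamma> = \<delta>"
proof
  fix t
  have eqn: thesis
    if geo: "geodesic_from stiefel (stiefel_metric \<beta>) x v \<gamma>"
      and that: "\<And>\<gamma>1 \<gamma>2. (\<And>t. (\<gamma> has_vector_derivative \<gamma>1 t) (at t)) \<Longrightarrow> (\<And>t. (\<gamma>1 has_vector_derivative \<gamma>2 t) (at t)) \<Longrightarrow>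
        \<gamma> 0 = x \<Longrightarrow> \<gamma>1 0 = v \<Longrightarrow>
        (\<And>t. \<gamma>2 t = (2 * (1 - \<beta>)) *\<^sub>R (\<gamma>1 t ** (transpose x ** v)) -
          \<gamma> t ** (transpose (\<gamma>1 t) ** \<gamma>1 t + (2 * (1 - \<beta>)) *\<^sub>R ((transpose x ** v) ** (transpose x ** v)))) \<Longrightarrow> thesis"
    for \<gamma> :: "real \<Rightarrow> real^'p^('p + 'q)" and thesis
  proof -
    have g: "geodesic stiefel (stiefel_metric \<beta>) \<gamma>" and "\<gamma> 0 = x" and v: "(\<gamma> has_vector_derivative v) (at 0)"
      using geo by (auto simp: geodesic_from_def)
    have "smooth_on UNIV \<gamma>" using g by (simp add: geodesic_def)
    then obtain \<gamma>1 \<gamma>2 where d: "\<And>t. (\<gamma> has_vector_derivative \<gamma>1 t) (at t)"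
      "\<And>t. (\<gamma>1 has_vector_derivative \<gamma>2 t) (at t)" "continuous_on UNIV \<gamma>2"
      by (rule smooth_curve_derivatives) blast
    have "\<gamma>1 0 = v" using vector_derivative_unique_at[OF d(1) v] .
    then show ?thesis
      using that[OF d(1,2) \<open>\<gamma> 0 = x\<close>] stiefel_geodesic_equation[OF \<open>\<beta> \<noteq> 0\<close> g d] \<open>\<gamma> 0 = x\<close> by blast
  qed
  define C where "C = transpose x ** v"
  define k where "k = 2 * (1 - \<beta>)"
  obtain \<gamma>1 \<gamma>2 where \<gamma>1: "\<And>t. (\<gamma> has_vector_derivative \<gamma>1 t) (at t)"
    and \<gamma>2: "\<And>t. (\<gamma>1 has_vector_derivative \<gamma>2 t) (at t)" and \<gamma>0: "\<gamma> 0 = x" "\<gamma>1 0 = v"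
    and \<gamma>: "\<And>t. \<gamma>2 t = k *\<^sub>R (\<gamma>1 t ** C) - \<gamma> t ** (transpose (\<gamma>1 t) ** \<gamma>1 t + k *\<^sub>R (C ** C))"
    unfolding C_def k_def by (rule eqn[OF geo(1)]) blast
  obtain \<delta>1 \<delta>2 where \<delta>1: "\<And>t. (\<delta> has_vector_derivative \<delta>1 t) (at t)"
    and \<delta>2: "\<And>t. (\<delta>1 has_vector_derivative \<delta>2 t) (at t)" and \<delta>0: "\<delta> 0 = x" "\<delta>1 0 = v"
    and \<delta>: "\<And>t. \<delta>2 t = k *\<^sub>R (\<delta>1 t ** C) - \<delta> t ** (transpose (\<delta>1 t) ** \<delta>1 t + k *\<^sub>R (C ** C))"
    unfolding C_def k_def by (rule eqn[OF geo(2)]) blast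
  have bdd: "\<exists>M. \<forall>s. \<bar>s\<bar> \<le> \<bar>t\<bar> \<longrightarrow> norm (f s) \<le> M" if "\<And>t. (f has_vector_derivative f' t) (at t)"
    for f f' :: "real \<Rightarrow> real^'p^('p + 'q)"
  proof -
    have "compact (f ` {-\<bar>t\<bar>..\<bar>t\<bar>})"
      using that by (intro compact_continuous_image continuous_at_imp_continuous_on)
        (auto intro: has_vector_derivative_continuous)
    then obtain M where "\<forall>y\<in>f ` {-\<bar>t\<bar>..\<bar>t\<bar>}. norm y \<le> M"
      using compact_imp_bounded bounded_iff by metis
    then show ?thesis by (intro exI[of _ M]) (auto simp: abs_le_iff)
  qed
  obtain M1 M2 M3 where M1: "\<And>s. \<bar>s\<bar> \<le> \<bar>t\<bar> \<Longrightarrow> norm (\<gamma>1 s) \<le> M1" and M2: "\<And>s. \<bar>s\<bar> \<le> \<bar>t\<bar> \<Longrightarrow> norm (\<delta>1 s) \<le> M2"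
    and M3: "\<And>s. \<bar>s\<bar> \<le> \<bar>t\<bar> \<Longrightarrow> norm (\<delta> s) \<le> M3"
    using bdd[OF \<gamma>2] bdd[OF \<delta>2] bdd[OF \<delta>1] by blast
  have M0: "0 \<le> M1" "0 \<le> M2" "0 \<le> M3"
    using M1[of 0] M2[of 0] M3[of 0] by (auto intro: order_trans[OF norm_ge_zero])
  \<comment> \<open>The summand 1 accounts for the velocity component of the pair; the others are
    the coefficients of the telescoped difference of the two right-hand sides.\<close>
  define L where "L = 1 + \<bar>k\<bar> * norm C + M1 * M1 + M3 * M1 + M3 * M2 + \<bar>k\<bar> * (norm C * norm C)"
  have "(\<gamma> t - \<delta> t, \<gamma>1 t - \<delta>1 t) = 0"
  proof (rule gronwall_zero[where T = "\<bar>t\<bar>" and M = L and f = "\<lambda>s. (\<gamma> s - \<delta> s, \<gamma>1 s - \<delta>1 s)"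
        and f' = "\<lambda>s. (\<gamma>1 s - \<delta>1 s, \<gamma>2 s - \<delta>2 s)"])
    show "((\<lambda>s. (\<gamma> s - \<delta> s, \<gamma>1 s - \<delta>1 s)) has_vector_derivative (\<gamma>1 s - \<delta>1 s, \<gamma>2 s - \<delta>2 s)) (at s)" for s
      by (intro has_vector_derivative_Pair has_vector_derivative_diff \<gamma>1 \<gamma>2 \<delta>1 \<delta>2)
    fix s assume s: "\<bar>s\<bar> \<le> \<bar>t\<bar>"
    define X where "X = \<gamma> s - \<delta> s"
    define Y where "Y = \<gamma>1 s - \<delta>1 s"
    define n where "n = norm (X, Y)"
    have X: "norm X \<le> n" and Y: "norm Y \<le> n"
      unfolding n_def by (rule norm_fst_le norm_snd_le)+
    have bound: "norm (A ** B) \<le> a * b" if "norm A \<le> a" "norm B \<le> b"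
      for A :: "real^'i::finite^'j::finite" and B :: "real^'k::finite^'i" and a b
      using norm_matrix_mult[of A B] mult_mono[OF that order_trans[OF norm_ge_zero that(1)] norm_ge_zero] by linarith
    \<comment> \<open>The triple product is telescoped, one factor being exchanged at a time, so
      that each summand contains \<open>X\<close> or \<open>Y\<close> exactly once.\<close>
    have "\<gamma>2 s - \<delta>2 s = k *\<^sub>R (Y ** C) - (X ** (transpose (\<gamma>1 s) ** \<gamma>1 s) + \<delta> s ** (transpose Y ** \<gamma>1 s) +
        \<delta> s ** (transpose (\<delta>1 s) ** Y) + k *\<^sub>R (X ** (C ** C)))"
      unfolding \<gamma> \<delta> X_def Y_def by (simp add: mat_simps algebra_simps)
    also have "norm \<dots> \<le> \<bar>k\<bar> * (n * norm C) + (n * (M1 * M1) + M3 * (n * M1) + M3 * (M2 * n) + \<bar>k\<bar> * (n * (norm C * norm C)))"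
    proof -
      have scale: "norm (k *\<^sub>R B) \<le> \<bar>k\<bar> * b" if "norm B \<le> b" for B :: "real^'p^('p + 'q)" and b
        using mult_left_mono[OF that abs_ge_zero[of k]] by simp
      note M = M1[OF s] M2[OF s] M3[OF s]
      have tM: "norm (transpose (\<gamma>1 s)) \<le> M1" "norm (transpose (\<delta>1 s)) \<le> M2" "norm (transpose Y) \<le> n"
        using M Y by simp_all
      show ?thesis
        by (rule order_trans[OF norm_triangle_ineq4 add_mono[OF scale[OF bound[OF Y order_refl]]
              order_trans[OF norm_triangle_ineq add_mono[OF
              order_trans[OF norm_triangle_ineq add_mono[OF
              order_trans[OF norm_triangle_ineq add_mono[OF
                bound[OF X bound[OF tM(1) M(1)]] bound[OF M(3) bound[OF tM(3) M(1)]]]]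
                bound[OF M(3) bound[OF tM(2) Y]]]] scale[OF bound[OF X norm_matrix_mult]]]]]])
    qed
    finally have "norm (\<gamma>2 s - \<delta>2 s) \<le> (L - 1) * n" by (simp add: L_def algebra_simps)
    moreover have "norm (Y, \<gamma>2 s - \<delta>2 s) \<le> norm Y + norm (\<gamma>2 s - \<delta>2 s)"
      by (simp add: norm_Pair sqrt_sum_squares_le_sum)
    ultimately show "norm (\<gamma>1 s - \<delta>1 s, \<gamma>2 s - \<delta>2 s) \<le> L * norm (\<gamma> s - \<delta> s, \<gamma>1 s - \<delta>1 s)"
      using Y by (simp add: X_def[symmetric] Y_def[symmetric] n_def[symmetric] algebra_simps)
  qed (auto simp: \<gamma>0 \<delta>0 zero_prod_def)
  then show "\<gamma> t = \<delta> t" by (simp add: zero_prod_def)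
qed

text \<open>The curves \<open>c X\<close> with constant \<open>X\<close> are closed under
  differentiation, \<open>X\<close> being replaced by \<open>\<Omega> ** X + X ** \<Psi>\<close>, so
  both derivatives are block computations. Here \<open>\<Psi>\<close> has the sign opposite to that
  in the theorem, which is why its exponential carries no minus.\<close>

lemma stiefel_geodesic_explicit:
  fixes Q :: "real^('p::finite + 'q::finite)^('p + 'q)" and A :: "real^'p^'p" and H :: "real^'p^'q" and \<beta> :: real
  defines "\<Omega> \<equiv> block ((2 * \<beta>) *\<^sub>R A) (- transpose H) H 0" and "\<Psi> \<equiv> (1 - 2 * \<beta>) *\<^sub>R A"
  assumes Q: "orthogonal_matrix Q" and "skew A"
  shows "geodesic_from stiefel (stiefel_metric \<beta>) (Q ** I_np) (Q ** stack A H)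
    (\<lambda>t. Q ** (matrix_exp (t *\<^sub>R \<Omega>) ** (I_np ** matrix_exp (t *\<^sub>R \<Psi>))))"
proof -
  have tA: "transpose A = - A" using \<open>skew A\<close> by (simp add: skew_def)
  define E where "E t = matrix_exp (t *\<^sub>R \<Omega>)" for t
  define F where "F t = matrix_exp (t *\<^sub>R \<Psi>)" for t
  define c where "c X t = Q ** (E t ** (X ** F t))" for X :: "real^'p^('p + 'q)" and t
  have dc: "(c X has_vector_derivative c (\<Omega> ** X + X ** \<Psi>) t) (at t)" for X t
    unfolding c_def E_def F_def
    by (auto intro!: derivative_eq_intros matrix_exp_has_vector_derivative simp: mat_simps)
      (simp add: matrix_mul_assoc[symmetric] matrix_exp_commute)
  have "skew \<Omega>" "skew \<Psi>"
    by (simp_all add: skew_def \<Omega>_def \<Psi>_def transpose_block block_arith transpose_simps tA)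
  then have orth: "orthogonal_matrix (E t)" "orthogonal_matrix (F t)" for t
    unfolding E_def F_def by (auto intro: orthogonal_matrix_exp_skew)
  have gram: "transpose (c X t) ** c Y t = transpose (F t) ** ((transpose X ** Y) ** F t)" for X Y t
    unfolding c_def orthogonal_matrix_gram[OF Q] orthogonal_matrix_gram[OF orth(1)]
    by (simp add: mat_simps)
  have FF: "transpose (F t) ** F t = mat 1" "F t ** transpose (F t) = mat 1" for t
    using orth(2)[of t] by (auto simp: orthogonal_matrix_def)
  have AF: "F t ** A = A ** F t" for t
    unfolding F_def by (rule matrix_exp_commute) (simp add: \<Psi>_def mat_simps)
  \<comment> \<open>The normal part of the Euler-Lagrange expression, seen in the moving frame. It
    is symmetric because \<open>A\<close> is skew, and conjugation by the orthogonal
    \<open>F t\<close> keeps it so.\<close>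
  define L where "L = (2 * \<beta> - 1) *\<^sub>R (A ** A) - transpose H ** H"
  define \<gamma>1 where "\<gamma>1 = c (stack A H)"
  define \<gamma>2 where "\<gamma>2 = c (stack (A ** A - transpose H ** H) ((2 - 2 * \<beta>) *\<^sub>R (H ** A)))"
  have "\<Omega> ** I_np + I_np ** \<Psi> = stack A H"
    by (simp add: \<Omega>_def \<Psi>_def I_np_def block_mult_stack stack_mult stack_arith mat_simps algebra_simps)
  then have \<gamma>1: "(c I_np has_vector_derivative \<gamma>1 t) (at t)" for t
    unfolding \<gamma>1_def by (metis dc)
  have "\<Omega> ** stack A H + stack A H ** \<Psi> = stack (A ** A - transpose H ** H) ((2 - 2 * \<beta>) *\<^sub>R (H ** A))"
    by (simp add: \<Omega>_def \<Psi>_def block_mult_stack stack_mult stack_arith stack_inject mat_simps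
        scaleR_left_diff_distrib scaleR_2)
  then have \<gamma>2: "(\<gamma>1 has_vector_derivative \<gamma>2 t) (at t)" for t
    unfolding \<gamma>1_def \<gamma>2_def by (metis dc)
  have "geodesic stiefel (stiefel_metric \<beta>) (c I_np)"
  proof (rule stiefel_geodesicI[OF _ _ \<gamma>1 \<gamma>2])
    show "smooth_on UNIV (c I_np)"
      unfolding smooth_on_def c_def[abs_def] E_def F_def
      by (intro allI Ck_on_bilinear[OF open_UNIV bounded_bilinear_matrix_mult] Ck_on_matrix_exp
          Ck_on_const Ck_on_linear bounded_linear_ident open_UNIV)
    show "range (c I_np) \<subseteq> stiefel"
      by (auto simp: stiefel_def gram gram_I_np FF)
    show "continuous_on UNIV \<gamma>2"
      unfolding \<gamma>2_def
      by (auto intro!: continuous_at_imp_continuous_on has_vector_derivative_continuous[OF dc])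
    show "transpose (transpose (F t) ** (L ** F t)) = transpose (F t) ** (L ** F t)" for t
      by (simp add: L_def mat_simps tA)
    fix t
    have C: "transpose (c I_np t) ** \<gamma>1 t = A"
      by (simp add: \<gamma>1_def gram transpose_I_np_stack AF[symmetric] matrix_mul_assoc FF)
    have "transpose (\<gamma>1 t) ** \<gamma>1 t + transpose (c I_np t) ** \<gamma>2 t =
        transpose (F t) ** ((transpose A ** A + transpose H ** H + (A ** A - transpose H ** H)) ** F t)"
      by (simp add: \<gamma>1_def \<gamma>2_def gram transpose_I_np_stack transpose_stack_mult mat_simps)
    then have C': "transpose (\<gamma>1 t) ** \<gamma>1 t + transpose (c I_np t) ** \<gamma>2 t = 0"
      by (simp add: tA mat_simps)
    have "\<gamma>1 t ** A = c (stack (A ** A) (H ** A)) t"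
      by (simp add: \<gamma>1_def c_def AF matrix_mul_assoc[symmetric] stack_mult[symmetric])
    then have "\<gamma>2 t - (1 - \<beta>) *\<^sub>R (2 *\<^sub>R (\<gamma>1 t ** A) + c I_np t ** 0) =
        c (stack (A ** A - transpose H ** H) ((2 - 2 * \<beta>) *\<^sub>R (H ** A)) - (2 - 2 * \<beta>) *\<^sub>R stack (A ** A) (H ** A)) t"
      by (simp add: \<gamma>2_def c_def mat_simps algebra_simps)
    also have "stack (A ** A - transpose H ** H) ((2 - 2 * \<beta>) *\<^sub>R (H ** A)) - (2 - 2 * \<beta>) *\<^sub>R stack (A ** A) (H ** A) =
        I_np ** L"
      by (simp add: stack_arith I_np_def stack_mult mat.zero_left)
        (simp add: L_def stack_inject scaleR_left_diff_distrib scaleR_2)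
    also have "c (I_np ** L) t = c I_np t ** (transpose (F t) ** (L ** F t))"
    proof -
      have "c I_np t ** (transpose (F t) ** (L ** F t)) = Q ** (E t ** (I_np ** ((F t ** transpose (F t)) ** (L ** F t))))"
        by (simp add: c_def matrix_mul_assoc)
      then show ?thesis by (simp add: FF c_def matrix_mul_assoc)
    qed
    finally show "\<gamma>2 t - (1 - \<beta>) *\<^sub>R (2 *\<^sub>R (\<gamma>1 t ** (transpose (c I_np t) ** \<gamma>1 t)) +
        c I_np t ** (transpose (\<gamma>1 t) ** \<gamma>1 t + transpose (c I_np t) ** \<gamma>2 t)) =
        c I_np t ** (transpose (F t) ** (L ** F t))"
      unfolding C C' .
  qed
  moreover have "c X 0 = Q ** X" for X by (simp add: c_def E_def F_def)
  ultimately show ?thesis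
    using \<gamma>1[of 0] unfolding geodesic_from_def \<gamma>1_def by (simp add: c_def[abs_def] E_def F_def)
qed

text \<open>Existence and uniqueness together make the definite description in
  \<open>riem_exp\<close> denote the explicit curve, taken here at time 1.\<close>

lemma riem_exp_stiefel:
  fixes Q :: "real^('p::finite + 'q::finite)^('p + 'q)" and A :: "real^'p^'p" and H :: "real^'p^'q"
  assumes "\<beta> \<noteq> 0" "orthogonal_matrix Q" "skew A"
  shows "riem_exp stiefel (stiefel_metric \<beta>) (Q ** I_np) (Q ** stack A H) =
    Q ** (matrix_exp (block ((2 * \<beta>) *\<^sub>R A) (- transpose H) H 0) ** (I_np ** matrix_exp ((1 - 2 * \<beta>) *\<^sub>R A)))"
proof -
  have "(THE \<gamma>. geodesic_from stiefel (stiefel_metric \<beta>) (Q ** I_np) (Q ** stack A H) \<gamma>) =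
      (\<lambda>t. Q ** (matrix_exp (t *\<^sub>R block ((2 * \<beta>) *\<^sub>R A) (- transpose H) H 0) **
        (I_np ** matrix_exp (t *\<^sub>R (1 - 2 * \<beta>) *\<^sub>R A))))"
    using stiefel_geodesic_explicit[OF assms(2,3)] stiefel_geodesic_unique[OF assms(1)]
    by (intro the_equality) blast+
  then show ?thesis by (simp add: riem_exp_def)
qed

subsection \<open>Critical points of the exponential map\<close>

lemma skew_add: "skew A \<Longrightarrow> skew B \<Longrightarrow> skew (A + B)"
  and skew_scaleR: "skew A \<Longrightarrow> skew (c *\<^sub>R A)"
  by (simp_all add: skew_def transpose_simps)

lemma stiefel_tangentI: "orthogonal_matrix Q \<Longrightarrow> skew A \<Longrightarrow> Q ** stack A H \<in> stiefel_tangent (Q ** I_np)"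
  by (auto simp: stiefel_tangent_def)

lemma stiefel_tangentE:
  fixes Q :: "real^('p::finite + 'q::finite)^('p + 'q)"
  assumes Q: "orthogonal_matrix Q" and v: "v \<in> stiefel_tangent (Q ** I_np)"
  obtains A H where "skew A" "v = Q ** stack A H"
proof -
  have *: "v = Q ** stack (\<chi> k. (transpose Q ** v) $ Inl k) (\<chi> l. (transpose Q ** v) $ Inr l)"
    using Q by (simp add: stack_surj orthogonal_matrix_cancel)
  then obtain A H where v': "v = Q ** stack A H" by blast
  then have "skew A"
    using v Q by (simp add: stiefel_tangent_iff orthogonal_matrix_gram transpose_I_np_stack)
  with v' show ?thesis using that by blast
qed

text \<open>On the tangent space \<open>riem_exp\<close> agrees with a formula \<open>?G\<close>
  that makes sense for all matrices and is differentiable; its derivative is then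
  restricted.\<close>

lemma riem_exp_stiefel_differentiable:
  fixes Q :: "real^('p::finite + 'q::finite)^('p + 'q)"
  assumes "\<beta> \<noteq> 0" and Q: "orthogonal_matrix Q" and v: "v \<in> stiefel_tangent (Q ** I_np)"
  shows "riem_exp stiefel (stiefel_metric \<beta>) (Q ** I_np) differentiable (at v within stiefel_tangent (Q ** I_np))"
proof -
  let ?A = "\<lambda>Y :: real^'p^('p + 'q). (\<chi> k. (transpose Q ** Y) $ Inl k) :: real^'p^'p"
  let ?H = "\<lambda>Y :: real^'p^('p + 'q). (\<chi> l. (transpose Q ** Y) $ Inr l) :: real^'p^'q"
  let ?\<Omega> = "\<lambda>Y. block ((2 * \<beta>) *\<^sub>R ?A Y) (- transpose (?H Y)) (?H Y) 0"
  let ?\<Psi> = "\<lambda>Y. (1 - 2 * \<beta>) *\<^sub>R ?A Y"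
  let ?G = "\<lambda>Y. Q ** (matrix_exp (?\<Omega> Y) ** (I_np ** matrix_exp (?\<Psi> Y)))"
  have bl: "bounded_linear ?\<Omega>" "bounded_linear ?\<Psi>"
    by (auto intro!: linearI simp: linear_conv_bounded_linear[symmetric] vec_eq_iff_sum block_def
        transpose_def mat.add_right mat.scaleR_right)
      (simp_all add: vec_eq_iff algebra_simps)
  have d: "(?\<Omega> has_derivative ?\<Omega>) (at v)" "(?\<Psi> has_derivative ?\<Psi>) (at v)"
    by (rule bounded_linear_imp_has_derivative, rule bl)+
  have "\<exists>D. (?G has_derivative D) (at v)"
    by (rule exI, rule mat.FDERIV[OF has_derivative_const mat.FDERIV[OF
            has_derivative_compose[where g = matrix_exp and f = ?\<Omega> and x = v, OF d(1) has_derivative_matrix_exp(2)]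
            mat.FDERIV[OF has_derivative_const
              has_derivative_compose[where g = matrix_exp and f = ?\<Psi> and x = v, OF d(2) has_derivative_matrix_exp(2)]]]])
  then obtain D where "(?G has_derivative D) (at v)" by blast
  then have D: "(?G has_derivative D) (at v within stiefel_tangent (Q ** I_np))"
    by (rule has_derivative_at_withinI)
  have eq: "riem_exp stiefel (stiefel_metric \<beta>) (Q ** I_np) w = ?G w"
    if w: "w \<in> stiefel_tangent (Q ** I_np)" for w
  proof -
    obtain A H where "skew A" and w: "w = Q ** stack A H" using stiefel_tangentE[OF Q w] .
    have "?A w = A" "?H w = H"
      unfolding w orthogonal_matrix_cancel(1)[OF Q] by (simp_all add: vec_eq_iff)
    then show ?thesis unfolding w by (simp only: riem_exp_stiefel[OF \<open>\<beta> \<noteq> 0\<close> Q \<open>skew A\<close>])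
  qed
  show ?thesis
    unfolding differentiable_def by (rule exI, rule has_derivative_transform[OF v eq D])
qed

text \<open>A derivative within the tangent space is not unique as a map on all matrices, but a line
  inside the tangent space determines its value at \<open>w\<close>. Hence D w = 0 = D 0 with w
  \<noteq> 0.\<close>

lemma exp_critical_stiefelI:
  fixes Q :: "real^('p::finite + 'q::finite)^('p + 'q)"
  assumes "\<beta> \<noteq> 0" and Q: "orthogonal_matrix Q"
    and v: "v \<in> stiefel_tangent (Q ** I_np)" and w: "w \<in> stiefel_tangent (Q ** I_np)" "w \<noteq> 0"
    and zero: "((\<lambda>s. riem_exp stiefel (stiefel_metric \<beta>) (Q ** I_np) (v + s *\<^sub>R w)) has_vector_derivative 0) (at 0)"
  shows "exp_critical stiefel stiefel_tangent (stiefel_metric \<beta>) (Q ** I_np) v"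
proof -
  let ?T = "stiefel_tangent (Q ** I_np)"
  let ?E = "riem_exp stiefel (stiefel_metric \<beta>) (Q ** I_np)"
  obtain D where D: "(?E has_derivative D) (at v within ?T)"
    using riem_exp_stiefel_differentiable[OF \<open>\<beta> \<noteq> 0\<close> Q v] by (auto simp: differentiable_def)
  have lin: "linear D" using has_derivative_bounded_linear[OF D] by (rule bounded_linear.linear)
  have T: "v + s *\<^sub>R w \<in> ?T" for s
    using v w by (simp add: stiefel_tangent_iff[OF Q] mat.add_right mat.scaleR_right skew_add skew_scaleR)
  have "(?E has_derivative D) (at (v + 0 *\<^sub>R w) within range (\<lambda>s. v + s *\<^sub>R w))"
    using has_derivative_subset[OF D, of "range (\<lambda>s. v + s *\<^sub>R w)"] T by auto
  then have "((\<lambda>s. ?E (v + s *\<^sub>R w)) has_derivative (\<lambda>h. D (h *\<^sub>R w))) (at 0)"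
    by (rule has_derivative_in_compose[rotated]) (auto intro!: derivative_eq_intros)
  moreover have "D (h *\<^sub>R w) = h *\<^sub>R D w" for h by (rule linear_scale[OF lin])
  ultimately have "((\<lambda>s. ?E (v + s *\<^sub>R w)) has_vector_derivative D w) (at 0)"
    by (simp add: has_vector_derivative_def)
  then have "D w = 0" using zero by (rule vector_derivative_unique_at)
  moreover have "0 \<in> ?T" by (simp add: stiefel_tangent_iff[OF Q] mat.zero_right skew_def transpose_simps)
  ultimately have "\<not> inj_on D ?T"
    using w linear_0[OF lin] by (metis inj_on_def)
  with v D show ?thesis by (auto simp: exp_critical_def)
qed

text \<open>On the span of \<open>P = H\<^sup>T H\<close> and \<open>S\<close> the matrix \<open>S\<close> acts as the imaginary unit, and the
  two blocks of the curve are the complex functions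
  \<open>(cos (r \<tau>) + \<i> \<beta> a sin (r \<tau>) / r) e\<^sup>\<theta>\<close> and \<open>(t + \<i> b) (sin (r \<tau>) / r) e\<^sup>\<theta>\<close> with
  \<open>\<theta> = \<i> (1 - \<beta>) a \<tau>\<close>.\<close>

lemma stiefel_exp_complex_structure:
  fixes S :: "real^'p::finite^'p" and H :: "real^'p^'q::finite" and a b t r \<beta> :: real
  assumes tS: "transpose S = - S" and SS: "S ** S = - (transpose H ** H)"
    and SP: "S ** (transpose H ** H) = S" and HP: "H ** (transpose H ** H) = H"
    and "r \<noteq> 0" and r: "r\<^sup>2 = t\<^sup>2 + \<beta>\<^sup>2 * a\<^sup>2 + b\<^sup>2"
  defines "h \<equiv> t *\<^sub>R H + b *\<^sub>R (H ** S)" and "\<theta> \<equiv> (1 - \<beta>) * a"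
  shows "matrix_exp (block ((2 * \<beta>) *\<^sub>R (a *\<^sub>R S)) (- transpose h) h 0) **
      (I_np ** matrix_exp ((1 - 2 * \<beta>) *\<^sub>R (a *\<^sub>R S))) =
    stack (mat 1 - transpose H ** H) 0
      + (cos r * cos \<theta> - \<beta> * a * (sin r / r) * sin \<theta>) *\<^sub>R stack (transpose H ** H) 0
      + (cos r * sin \<theta> + \<beta> * a * (sin r / r) * cos \<theta>) *\<^sub>R stack S 0
      + (sin r / r * (t * cos \<theta> - b * sin \<theta>)) *\<^sub>R stack 0 H
      + (sin r / r * (t * sin \<theta> + b * cos \<theta>)) *\<^sub>R stack 0 (H ** S)"
proof -
  define P where "P = transpose H ** H"
  note SS = SS[folded P_def] and SP = SP[folded P_def] and HP = HP[folded P_def]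
  have tP: "transpose P = P" by (simp add: P_def matrix_transpose_mul)
  have PS: "P ** S = S"
    using arg_cong[OF SP, of transpose] by (simp add: matrix_transpose_mul tS tP mat.minus_right)
  have tHH: "transpose H ** (H ** X) = P ** X" for X :: "real^'p^'p" by (simp add: P_def matrix_mul_assoc)
  have PP: "P ** P = P" using HP tHH[of P] by (simp add: P_def[symmetric])
  have HSS: "(H ** S) ** S = - H" and HSP: "(H ** S) ** P = H ** S"
    by (simp_all add: matrix_mul_assoc[symmetric] SS SP mat.minus_right HP)
  have hH: "transpose h ** H = t *\<^sub>R P - b *\<^sub>R S"
    and hHS: "transpose h ** (H ** S) = t *\<^sub>R S + b *\<^sub>R P"
  proof -
    have th: "transpose h = t *\<^sub>R transpose H - b *\<^sub>R (S ** transpose H)"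
      by (simp add: h_def transpose_simps matrix_transpose_mul tS mat.minus_left)
    show 1: "transpose h ** H = t *\<^sub>R P - b *\<^sub>R S"
      by (simp add: th mat.diff_left mat.scaleR_left matrix_mul_assoc[symmetric] P_def[symmetric] SP)
    show "transpose h ** (H ** S) = t *\<^sub>R S + b *\<^sub>R P"
      unfolding matrix_mul_assoc 1 by (simp add: mat.diff_left mat.scaleR_left PS SS)
  qed
  have hP: "h ** P = h" and hS: "h ** S = t *\<^sub>R (H ** S) - b *\<^sub>R H"
    by (simp_all add: h_def mat.add_left mat.scaleR_left HP HSS HSP)
  define \<Omega> where "\<Omega> = block ((2 * \<beta>) *\<^sub>R (a *\<^sub>R S)) (- transpose h) h 0"
  define \<Psi> where "\<Psi> = (1 - 2 * \<beta>) *\<^sub>R (a *\<^sub>R S)"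
  \<comment> \<open>The curve solves Y' = L Y. The five matrices treated below span an invariant
    space, the first of them being annihilated, so the exponential reduces to four scalar
    equations.\<close>
  define L where "L Y = \<Omega> ** Y + Y ** \<Psi>" for Y
  have L_stack: "L (stack X Y) = stack (((2 * \<beta> * a) *\<^sub>R (S ** X) + ((1 - 2 * \<beta>) * a) *\<^sub>R (X ** S)) - transpose h ** Y)
      (h ** X + ((1 - 2 * \<beta>) * a) *\<^sub>R (Y ** S))" for X Y
    by (simp add: L_def \<Omega>_def \<Psi>_def block_mult_stack stack_mult stack_arith stack_inject
        mat.scaleR_left mat.scaleR_right mat.minus_left mat.zero_left)
  have sc: "(2 * \<beta> * a) *\<^sub>R X + ((1 - 2 * \<beta>) * a) *\<^sub>R X = a *\<^sub>R X" for X :: "real^'p^'p"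
    unfolding scaleR_add_left[symmetric] by (simp add: algebra_simps)
  have L0: "L (stack (mat 1 - P) 0) = 0"
    by (simp add: L_stack mat.diff_left mat.diff_right mat.zero_left mat.zero_right SP PS hP stack_arith)
  have L1: "L (stack P 0) = a *\<^sub>R stack S 0 + t *\<^sub>R stack 0 H + b *\<^sub>R stack 0 (H ** S)"
    unfolding L_stack SP PS sc hP by (simp add: mat.zero_left mat.zero_right h_def stack_arith)
  have L2: "L (stack S 0) = - a *\<^sub>R stack P 0 + t *\<^sub>R stack 0 (H ** S) - b *\<^sub>R stack 0 H"
    unfolding L_stack SS sc by (simp add: mat.zero_left mat.zero_right hS stack_arith)
  have L3: "L (stack 0 H) = - t *\<^sub>R stack P 0 + b *\<^sub>R stack S 0 + ((1 - 2 * \<beta>) * a) *\<^sub>R stack 0 (H ** S)"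
    unfolding L_stack hH by (simp add: mat.zero_left mat.zero_right stack_arith)
  have L4: "L (stack 0 (H ** S)) = - t *\<^sub>R stack S 0 - b *\<^sub>R stack P 0 - ((1 - 2 * \<beta>) * a) *\<^sub>R stack 0 H"
    unfolding L_stack hHS HSS by (simp add: mat.zero_left mat.zero_right stack_arith)
  have linL: "bounded_linear L"
    by (auto intro!: linearI simp: linear_conv_bounded_linear[symmetric] L_def mat.add_left mat.add_right
        mat.scaleR_left mat.scaleR_right scaleR_add_right)
  \<comment> \<open>With z = x1 + i x2 and w = y1 + i y2 the scalar equations read z' = i a z - (t -
    i b) w and w' = (t + i b) z + i (1 - 2 \<beta>) a w. Half the trace of this system is i
    \<theta>, and its traceless part has square - r^2; hence the phase and the functions cos(r
    \<tau>), sin(r \<tau>) / r.\<close>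
  define c where "c \<tau> = cos (r * \<tau>)" for \<tau>
  define \<sigma> where "\<sigma> \<tau> = sin (r * \<tau>) / r" for \<tau>
  define C where "C \<tau> = cos (\<theta> * \<tau>)" for \<tau>
  define \<Sigma> where "\<Sigma> \<tau> = sin (\<theta> * \<tau>)" for \<tau>
  have dc: "(c has_real_derivative - (t * t + \<beta> * \<beta> * a * a + b * b) * \<sigma> \<tau>) (at \<tau>)" for \<tau>
  proof -
    have "(c has_real_derivative - r * sin (r * \<tau>)) (at \<tau>)"
      unfolding c_def[abs_def] by (auto intro!: derivative_eq_intros)
    moreover have "- r * sin (r * \<tau>) = - r\<^sup>2 * \<sigma> \<tau>"
      using \<open>r \<noteq> 0\<close> by (simp add: \<sigma>_def power2_eq_square)
    ultimately show ?thesis unfolding r by (simp add: power2_eq_square mult_ac)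
  qed
  have d\<sigma>: "(\<sigma> has_real_derivative c \<tau>) (at \<tau>)" for \<tau>
    unfolding \<sigma>_def[abs_def] c_def using \<open>r \<noteq> 0\<close> by (auto intro!: derivative_eq_intros)
  have dC: "(C has_real_derivative - \<theta> * \<Sigma> \<tau>) (at \<tau>)" and d\<Sigma>: "(\<Sigma> has_real_derivative \<theta> * C \<tau>) (at \<tau>)" for \<tau>
    unfolding C_def[abs_def] \<Sigma>_def[abs_def] by (auto intro!: derivative_eq_intros)
  define x1 where "x1 \<tau> = c \<tau> * C \<tau> - \<beta> * a * \<sigma> \<tau> * \<Sigma> \<tau>" for \<tau>
  define x2 where "x2 \<tau> = c \<tau> * \<Sigma> \<tau> + \<beta> * a * \<sigma> \<tau> * C \<tau>" for \<tau>
  define y1 where "y1 \<tau> = \<sigma> \<tau> * (t * C \<tau> - b * \<Sigma> \<tau>)" for \<tau>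
  define y2 where "y2 \<tau> = \<sigma> \<tau> * (t * \<Sigma> \<tau> + b * C \<tau>)" for \<tau>
  note d = dc d\<sigma> dC d\<Sigma>
  have dx1: "(x1 has_real_derivative - a * x2 \<tau> - t * y1 \<tau> - b * y2 \<tau>) (at \<tau>)" for \<tau>
    unfolding x1_def[abs_def] by (rule derivative_eq_intros d | (rule refl))+
      (simp add: x2_def y1_def y2_def \<theta>_def algebra_simps)
  have dx2: "(x2 has_real_derivative a * x1 \<tau> - t * y2 \<tau> + b * y1 \<tau>) (at \<tau>)" for \<tau>
    unfolding x2_def[abs_def] by (rule derivative_eq_intros d | (rule refl))+
      (simp add: x1_def y1_def y2_def \<theta>_def algebra_simps)
  have dy1: "(y1 has_real_derivative t * x1 \<tau> - b * x2 \<tau> - (1 - 2 * \<beta>) * a * y2 \<tau>) (at \<tau>)" for \<tau>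
    unfolding y1_def[abs_def] by (rule derivative_eq_intros d | (rule refl))+
      (simp add: x1_def x2_def y2_def \<theta>_def algebra_simps)
  have dy2: "(y2 has_real_derivative b * x1 \<tau> + t * x2 \<tau> + (1 - 2 * \<beta>) * a * y1 \<tau>) (at \<tau>)" for \<tau>
    unfolding y2_def[abs_def] by (rule derivative_eq_intros d | (rule refl))+
      (simp add: x1_def x2_def y1_def \<theta>_def algebra_simps)
  define g where "g \<tau> = stack (mat 1 - P) 0 + x1 \<tau> *\<^sub>R stack P 0 + x2 \<tau> *\<^sub>R stack S 0
      + y1 \<tau> *\<^sub>R stack 0 H + y2 \<tau> *\<^sub>R stack 0 (H ** S)" for \<tau>
  have "matrix_exp (1 *\<^sub>R \<Omega>) ** (I_np ** matrix_exp (1 *\<^sub>R \<Psi>)) = g 1"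
  proof (rule linear_ode_unique[OF linL, where f = "\<lambda>\<tau>. matrix_exp (\<tau> *\<^sub>R \<Omega>) ** (I_np ** matrix_exp (\<tau> *\<^sub>R \<Psi>))"])
    show "((\<lambda>\<tau>. matrix_exp (\<tau> *\<^sub>R \<Omega>) ** (I_np ** matrix_exp (\<tau> *\<^sub>R \<Psi>))) has_vector_derivative
        L (matrix_exp (\<tau> *\<^sub>R \<Omega>) ** (I_np ** matrix_exp (\<tau> *\<^sub>R \<Psi>)))) (at \<tau>)" for \<tau>
      by (auto intro!: derivative_eq_intros matrix_exp_has_vector_derivative simp: L_def mat_simps)
        (simp add: matrix_mul_assoc[symmetric] matrix_exp_commute)
    have "(g has_vector_derivative (- a * x2 \<tau> - t * y1 \<tau> - b * y2 \<tau>) *\<^sub>R stack P 0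
        + (a * x1 \<tau> - t * y2 \<tau> + b * y1 \<tau>) *\<^sub>R stack S 0
        + (t * x1 \<tau> - b * x2 \<tau> - (1 - 2 * \<beta>) * a * y2 \<tau>) *\<^sub>R stack 0 H
        + (b * x1 \<tau> + t * x2 \<tau> + (1 - 2 * \<beta>) * a * y1 \<tau>) *\<^sub>R stack 0 (H ** S)) (at \<tau>)" for \<tau>
      unfolding g_def[abs_def]
      using has_vector_derivative_add[OF has_vector_derivative_add[OF has_vector_derivative_add[OF
          has_vector_derivative_add[OF has_vector_derivative_const
            has_vector_derivative_scaleR[OF dx1 has_vector_derivative_const]]
          has_vector_derivative_scaleR[OF dx2 has_vector_derivative_const]]
          has_vector_derivative_scaleR[OF dy1 has_vector_derivative_const]]
          has_vector_derivative_scaleR[OF dy2 has_vector_derivative_const]] by simp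
    moreover have "L (g \<tau>) = (- a * x2 \<tau> - t * y1 \<tau> - b * y2 \<tau>) *\<^sub>R stack P 0
        + (a * x1 \<tau> - t * y2 \<tau> + b * y1 \<tau>) *\<^sub>R stack S 0
        + (t * x1 \<tau> - b * x2 \<tau> - (1 - 2 * \<beta>) * a * y2 \<tau>) *\<^sub>R stack 0 H
        + (b * x1 \<tau> + t * x2 \<tau> + (1 - 2 * \<beta>) * a * y1 \<tau>) *\<^sub>R stack 0 (H ** S)" for \<tau>
    proof -
      note lin = linear_add[OF bounded_linear.linear[OF linL]] linear_scale[OF bounded_linear.linear[OF linL]]
      show ?thesis
        unfolding g_def lin L0 L1 L2 L3 L4
        by (simp only: scaleR_add_left scaleR_add_right scaleR_diff_left scaleR_diff_right scaleR_minus_left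
            scaleR_scaleR) (simp add: mult_ac algebra_simps)
    qed
    ultimately show "(g has_vector_derivative L (g \<tau>)) (at \<tau>)" for \<tau> by simp
    show "matrix_exp (0 *\<^sub>R \<Omega>) ** (I_np ** matrix_exp (0 *\<^sub>R \<Psi>)) = g 0"
      by (simp add: g_def x1_def x2_def y1_def y2_def c_def \<sigma>_def C_def \<Sigma>_def I_np_def stack_arith)
  qed
  then show ?thesis
    by (simp add: g_def x1_def x2_def y1_def y2_def c_def \<sigma>_def C_def \<Sigma>_def P_def \<Omega>_def \<Psi>_def)
qed

text \<open>Along the perturbation the coefficients of H^T H and H are stationary to first order;
  the two quantities required to vanish are the derivatives of the coefficients of S and H
  S.\<close>

lemma stiefel_exp_critical:
  fixes Q :: "real^('p::finite + 'q::finite)^('p + 'q)" and S :: "real^'p^'p" and H :: "real^'p^'q"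
    and a b t \<beta> :: real
  assumes "\<beta> \<noteq> 0" and Q: "orthogonal_matrix Q"
    and S: "transpose S = - S" "S ** S = - (transpose H ** H)" "S ** (transpose H ** H) = S"
      "H ** (transpose H ** H) = H" and "S \<noteq> 0"
    and "t > 0" and ab: "a \<noteq> 0 \<or> b \<noteq> 0"
    and zero: "a * ((1 - \<beta>) * cos t + \<beta> * (sin t / t)) = 0" "sin t / t * (t * (1 - \<beta>) * a + b) = 0"
  shows "exp_critical stiefel stiefel_tangent (stiefel_metric \<beta>) (Q ** I_np) (t *\<^sub>R (Q ** stack 0 H))"
proof (rule exp_critical_stiefelI[OF \<open>\<beta> \<noteq> 0\<close> Q])
  let ?w = "Q ** stack (a *\<^sub>R S) (b *\<^sub>R (H ** S))"
  have v: "t *\<^sub>R (Q ** stack 0 H) = Q ** stack 0 (t *\<^sub>R H)"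
    by (simp add: mat.scaleR_right[symmetric] stack_arith)
  show "t *\<^sub>R (Q ** stack 0 H) \<in> stiefel_tangent (Q ** I_np)"
    unfolding v by (rule stiefel_tangentI[OF Q]) (simp add: skew_def transpose_simps)
  have "skew S" using S by (simp add: skew_def)
  then show "?w \<in> stiefel_tangent (Q ** I_np)"
    by (intro stiefel_tangentI[OF Q] skew_scaleR)
  have PS: "transpose H ** (H ** S) = S"
    using arg_cong[OF S(3), of transpose]
    by (simp add: matrix_transpose_mul S(1) mat.minus_right matrix_mul_assoc)
  then have "H ** S \<noteq> 0" using \<open>S \<noteq> 0\<close> by (auto simp: mat.zero_right)
  then have "stack (a *\<^sub>R S) (b *\<^sub>R (H ** S)) \<noteq> 0"
    using ab \<open>S \<noteq> 0\<close> unfolding stack_arith(5)[symmetric] stack_inject by auto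
  then show "?w \<noteq> 0"
    using orthogonal_matrix_cancel(1)[OF Q] by (metis mat.zero_right)
  \<comment> \<open>The perturbation \<open>s *\<^sub>R ?w\<close> multiplies a and b by
    \<open>s\<close>. They enter \<open>r\<close> only through their squares, so \<open>r\<close> is
    stationary at 0.\<close>
  define r where "r s = sqrt (t\<^sup>2 + \<beta>\<^sup>2 * (s * a)\<^sup>2 + (s * b)\<^sup>2)" for s
  have r0: "r 0 = t" using \<open>t > 0\<close> by (simp add: r_def)
  have pos: "t\<^sup>2 + \<beta>\<^sup>2 * (s * a)\<^sup>2 + (s * b)\<^sup>2 > 0" for s
    using \<open>t > 0\<close> by (simp add: add_pos_nonneg)
  have dr: "(r has_real_derivative 0) (at 0)"
    unfolding r_def[abs_def] using pos[of 0] by (auto intro!: derivative_eq_intros)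
  define \<theta> where "\<theta> s = (1 - \<beta>) * (s * a)" for s
  have d\<theta>: "(\<theta> has_real_derivative (1 - \<beta>) * a) (at 0)" and \<theta>0: "\<theta> 0 = 0"
    unfolding \<theta>_def[abs_def] by (auto intro!: derivative_eq_intros)
  have d1: "((\<lambda>s. cos (r s) * cos (\<theta> s) - \<beta> * (s * a) * (sin (r s) / r s) * sin (\<theta> s)) has_real_derivative 0) (at 0)"
    using \<open>t > 0\<close> by (auto intro!: derivative_eq_intros dr d\<theta> simp: r0 \<theta>0)
  have d2: "((\<lambda>s. cos (r s) * sin (\<theta> s) + \<beta> * (s * a) * (sin (r s) / r s) * cos (\<theta> s)) has_real_derivative 0) (at 0)"
    using \<open>t > 0\<close> zero(1) by (auto intro!: derivative_eq_intros dr d\<theta> simp: r0 \<theta>0 algebra_simps)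
  have d3: "((\<lambda>s. sin (r s) / r s * (t * cos (\<theta> s) - s * b * sin (\<theta> s))) has_real_derivative 0) (at 0)"
    using \<open>t > 0\<close> by (auto intro!: derivative_eq_intros dr d\<theta> simp: r0 \<theta>0)
  have "((\<lambda>s. sin (r s) / r s * (t * sin (\<theta> s) + s * b * cos (\<theta> s))) has_real_derivative
      sin t / t * (t * (1 - \<beta>) * a + b)) (at 0)"
    using \<open>t > 0\<close> by (auto intro!: derivative_eq_intros dr d\<theta> simp: r0 \<theta>0 mult_ac)
  then have d4: "((\<lambda>s. sin (r s) / r s * (t * sin (\<theta> s) + s * b * cos (\<theta> s))) has_real_derivative 0) (at 0)"
    by (simp only: zero(2))
  define R where "R s = stack (mat 1 - transpose H ** H) 0
      + (cos (r s) * cos (\<theta> s) - \<beta> * (s * a) * (sin (r s) / r s) * sin (\<theta> s)) *\<^sub>R stack (transpose H ** H) 0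
      + (cos (r s) * sin (\<theta> s) + \<beta> * (s * a) * (sin (r s) / r s) * cos (\<theta> s)) *\<^sub>R stack S 0
      + (sin (r s) / r s * (t * cos (\<theta> s) - s * b * sin (\<theta> s))) *\<^sub>R stack 0 H
      + (sin (r s) / r s * (t * sin (\<theta> s) + s * b * cos (\<theta> s))) *\<^sub>R stack 0 (H ** S)" for s
  have "(R has_vector_derivative 0) (at 0)"
    unfolding R_def[abs_def]
    using has_vector_derivative_add[OF has_vector_derivative_add[OF has_vector_derivative_add[OF
          has_vector_derivative_add[OF has_vector_derivative_const
            has_vector_derivative_scaleR[OF d1 has_vector_derivative_const]]
          has_vector_derivative_scaleR[OF d2 has_vector_derivative_const]]
          has_vector_derivative_scaleR[OF d3 has_vector_derivative_const]]
          has_vector_derivative_scaleR[OF d4 has_vector_derivative_const]] by simp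
  then have "((\<lambda>s. Q ** R s) has_vector_derivative 0) (at 0)"
    using bounded_linear.has_vector_derivative[OF mat.bounded_linear_right, of R 0 "at 0" Q] by (simp add: mat.zero_right)
  moreover have "riem_exp stiefel (stiefel_metric \<beta>) (Q ** I_np) (t *\<^sub>R (Q ** stack 0 H) + s *\<^sub>R ?w) = Q ** R s" for s
  proof -
    have "t *\<^sub>R (Q ** stack 0 H) + s *\<^sub>R ?w = Q ** stack ((s * a) *\<^sub>R S) (t *\<^sub>R H + (s * b) *\<^sub>R (H ** S))"
      by (simp add: mat.scaleR_right[symmetric] mat.add_right[symmetric] stack_arith)
    moreover have "r s \<noteq> 0" "(r s)\<^sup>2 = t\<^sup>2 + \<beta>\<^sup>2 * (s * a)\<^sup>2 + (s * b)\<^sup>2"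
      using pos[of s] by (auto simp: r_def)
    ultimately show ?thesis
      using riem_exp_stiefel[OF \<open>\<beta> \<noteq> 0\<close> Q skew_scaleR[OF \<open>skew S\<close>, of "s * a"]]
        stiefel_exp_complex_structure[OF S, of "r s" t \<beta> "s * a" "s * b"]
      by (simp add: R_def \<theta>_def)
  qed
  ultimately show "((\<lambda>s. riem_exp stiefel (stiefel_metric \<beta>) (Q ** I_np) (t *\<^sub>R (Q ** stack 0 H) + s *\<^sub>R ?w))
      has_vector_derivative 0) (at 0)"
    by simp
qed

subsection \<open>Homogeneity of the conjugate radius\<close>

lemma stiefel_tangent_orthogonal:
  assumes P: "orthogonal_matrix P" and X: "X \<in> stiefel"
  shows "v \<in> stiefel_tangent (P ** X) \<longleftrightarrow> transpose P ** v \<in> stiefel_tangent X"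
proof -
  obtain Q where Q: "orthogonal_matrix Q" and X: "X = Q ** I_np" using X stiefel_completion by blast
  show ?thesis
    using stiefel_tangent_iff[OF orthogonal_matrix_mul[OF P Q], of v] stiefel_tangent_iff[OF Q, of "transpose P ** v"]
    by (simp add: X matrix_mul_assoc matrix_transpose_mul)
qed

text \<open>In the closed formula the frame occurs as a left factor only.\<close>

lemma riem_exp_orthogonal:
  assumes "\<beta> \<noteq> 0" and P: "orthogonal_matrix P" and X: "X \<in> stiefel" and v: "v \<in> stiefel_tangent X"
  shows "riem_exp stiefel (stiefel_metric \<beta>) (P ** X) (P ** v) = P ** riem_exp stiefel (stiefel_metric \<beta>) X v"
proof -
  obtain Q where Q: "orthogonal_matrix Q" and X: "X = Q ** I_np" using X stiefel_completion by blast
  obtain A H where A: "skew A" and v: "v = Q ** stack A H" using stiefel_tangentE[OF Q] v X by blast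
  show ?thesis
    using riem_exp_stiefel[OF \<open>\<beta> \<noteq> 0\<close> orthogonal_matrix_mul[OF P Q] A, of H] riem_exp_stiefel[OF \<open>\<beta> \<noteq> 0\<close> Q A, of H]
    by (simp add: X v matrix_mul_assoc)
qed

text \<open>The exponential at P X is the one at X with P^T applied before and P after, so its
  derivative is P D P^T, and failure of injectivity carries over.\<close>

lemma exp_critical_orthogonal:
  assumes "\<beta> \<noteq> 0" and P: "orthogonal_matrix P" and X: "X \<in> stiefel"
    and crit: "exp_critical stiefel stiefel_tangent (stiefel_metric \<beta>) X v"
  shows "exp_critical stiefel stiefel_tangent (stiefel_metric \<beta>) (P ** X) (P ** v)"
proof -
  let ?E = "riem_exp stiefel (stiefel_metric \<beta>)"
  obtain D where v: "v \<in> stiefel_tangent X"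
    and D: "(?E X has_derivative D) (at v within stiefel_tangent X)" and inj: "\<not> inj_on D (stiefel_tangent X)"
    using crit by (auto simp: exp_critical_def)
  note T = stiefel_tangent_orthogonal[OF P X]
  note cancel = orthogonal_matrix_cancel[OF P]
  have Pv: "P ** v \<in> stiefel_tangent (P ** X)" using v by (simp add: T cancel)
  have "(?E X has_derivative D) (at (transpose P ** (P ** v)) within (**) (transpose P) ` stiefel_tangent (P ** X))"
    unfolding cancel by (rule has_derivative_subset[OF D]) (auto simp: T)
  from bounded_linear.has_derivative[OF mat.bounded_linear_right
      has_derivative_in_compose[OF bounded_linear_imp_has_derivative[OF mat.bounded_linear_right] this], of P]
  have der: "((\<lambda>w. P ** ?E X (transpose P ** w)) has_derivative (\<lambda>w. P ** D (transpose P ** w)))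
      (at (P ** v) within stiefel_tangent (P ** X))" .
  have eq: "?E (P ** X) w = P ** ?E X (transpose P ** w)" if "w \<in> stiefel_tangent (P ** X)" for w
    using riem_exp_orthogonal[OF \<open>\<beta> \<noteq> 0\<close> P X, of "transpose P ** w"] that by (simp add: T cancel)
  have "(?E (P ** X) has_derivative (\<lambda>w. P ** D (transpose P ** w)))
      (at (P ** v) within stiefel_tangent (P ** X))"
    by (rule has_derivative_transform[OF Pv eq der])
  moreover have "\<not> inj_on (\<lambda>w. P ** D (transpose P ** w)) (stiefel_tangent (P ** X))"
  proof
    assume *: "inj_on (\<lambda>w. P ** D (transpose P ** w)) (stiefel_tangent (P ** X))"
    have "inj_on D (stiefel_tangent X)"
    proof (rule inj_onI)
      fix x y assume xy: "x \<in> stiefel_tangent X" "y \<in> stiefel_tangent X" and "D x = D y"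
      then have "P ** D (transpose P ** (P ** x)) = P ** D (transpose P ** (P ** y))"
        by (simp only: cancel)
      moreover have "P ** x \<in> stiefel_tangent (P ** X)" "P ** y \<in> stiefel_tangent (P ** X)"
        unfolding T cancel by (rule xy)+
      ultimately have "P ** x = P ** y" by (rule inj_onD[OF *])
      then have "transpose P ** (P ** x) = transpose P ** (P ** y)" by (rule arg_cong)
      then show "x = y" unfolding cancel .
    qed
    with inj show False by simp
  qed
  ultimately show ?thesis using Pv by (auto simp: exp_critical_def)
qed

lemma conj_radius_orthogonal:
  fixes P :: "real^('p::finite + 'q::finite)^('p + 'q)" and X :: "real^'p^('p + 'q)"
  assumes "\<beta> \<noteq> 0" and P: "orthogonal_matrix P" and X: "X \<in> stiefel"
  shows "conj_radius stiefel stiefel_tangent (stiefel_metric \<beta>) (P ** X) =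
    conj_radius stiefel stiefel_tangent (stiefel_metric \<beta>) X"
proof -
  define free where "free Y r \<longleftrightarrow> (\<forall>v\<in>stiefel_tangent Y. sqrt (stiefel_metric \<beta> Y v v) < r \<longrightarrow>
      \<not> exp_critical stiefel stiefel_tangent (stiefel_metric \<beta>) Y v)"
    for Y :: "real^'p^('p + 'q)" and r
  have free: "free Y r" if "free (R ** Y) r" "orthogonal_matrix R" "Y \<in> stiefel" for R Y r
    unfolding free_def
  proof (intro ballI impI notI)
    fix v assume v: "v \<in> stiefel_tangent Y" "sqrt (stiefel_metric \<beta> Y v v) < r"
      and crit: "exp_critical stiefel stiefel_tangent (stiefel_metric \<beta>) Y v"
    have "R ** v \<in> stiefel_tangent (R ** Y)"
      using v by (simp add: stiefel_tangent_orthogonal[OF that(2,3)] orthogonal_matrix_cancel[OF that(2)])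
    moreover have "stiefel_metric \<beta> (R ** Y) (R ** v) (R ** v) = stiefel_metric \<beta> Y v v"
      by (simp add: stiefel_metric_inner orthogonal_mult_stiefel that orthogonal_matrix_gram
          inner_matrix_mult_left orthogonal_matrix_cancel)
    ultimately show False
      using that(1) v exp_critical_orthogonal[OF \<open>\<beta> \<noteq> 0\<close> that(2,3) crit] unfolding free_def by simp
  qed
  \<comment> \<open>The converse is the same implication for the inverse matrix P^T.\<close>
  have "free (P ** X) r \<longleftrightarrow> free X r" for r
    using free[of P X r] free[of "transpose P" "P ** X" r] assms orthogonal_mult_stiefel[OF P X]
    by (auto simp: orthogonal_matrix_cancel)
  then show ?thesis by (simp add: conj_radius_def free_def[symmetric])
qed

subsection \<open>The first root\<close>

text \<open>The derivative x sin x is nonnegative on [0, \<pi>]. The inequality excludes roots below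
  \<pi> when \<beta> \<ge> 1.\<close>

lemma sin_minus_x_cos_nonneg: "0 \<le> sin m - m * cos m" if "0 \<le> m" "m \<le> pi" for m :: real
proof -
  have "sin 0 - 0 * cos 0 \<le> sin m - m * cos m"
  proof (rule DERIV_nonneg_imp_nondecreasing[where f = "\<lambda>x. sin x - x * cos x"])
    fix x assume "0 \<le> x" "x \<le> m"
    then have 1: "0 \<le> x * sin x"
      using that by (simp add: sin_ge_zero)
    have 2: "((\<lambda>x. sin x - x * cos x) has_real_derivative x * sin x) (at x)"
      using DERIV_diff[OF DERIV_sin DERIV_mult[OF DERIV_ident DERIV_cos], of x] by (simp add: mult.commute)
    show "\<exists>D. ((\<lambda>x. sin x - x * cos x) has_real_derivative D) (at x) \<and> 0 \<le> D"
      by (rule exI[where x = "x * sin x"], rule conjI[OF 2 1])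
  qed (use that in simp)
  then show ?thesis by simp
qed

text \<open>\<open>LEAST\<close> over the reals has the expected meaning only if the minimum is
  attained. The roots stay away from 0 because the cleared equation has slope 1 + c = 1 / \<beta> >
  0 there, so the first root is a minimum over a compact set.\<close>

lemma t_r_root:
  fixes \<beta> \<alpha> :: real
  assumes "\<beta> > 0" and \<alpha>: "\<alpha> = 1 / (2 * \<beta>) - 1"
  shows "0 < t_r \<alpha>" "sin (t_r \<alpha>) / t_r \<alpha> + (1 / \<beta> - 1) * cos (t_r \<alpha>) = 0"
    and "\<beta> \<le> 1 \<Longrightarrow> t_r \<alpha> \<le> pi" "\<beta> \<ge> 1 \<Longrightarrow> pi \<le> t_r \<alpha>"
proof -
  define c where "c = 1 / \<beta> - 1"
  have c: "1 + 2 * \<alpha> = c" using \<open>\<beta> > 0\<close> by (simp add: c_def \<alpha> field_simps)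
  have "c > -1" using \<open>\<beta> > 0\<close> by (simp add: c_def)
  \<comment> \<open>The equation multiplied by t, which makes it continuous at 0.\<close>
  define h where "h t = sin t + c * t * cos t" for t
  define Z where "Z t \<longleftrightarrow> 0 < t \<and> sin t / t + c * cos t = 0" for t
  have Z: "Z t \<longleftrightarrow> 0 < t \<and> h t = 0" for t by (auto simp: Z_def h_def field_simps)
  have cont: "continuous_on S h" for S unfolding h_def[abs_def] by (intro continuous_intros)
  have "(h has_real_derivative 1 + c) (at 0)"
    unfolding h_def[abs_def] by (auto intro!: derivative_eq_intros)
  from DERIV_pos_inc_right[OF this] \<open>c > -1\<close> obtain d where "d > 0"
    and "\<And>x. 0 < x \<Longrightarrow> x < d \<Longrightarrow> h 0 < h (0 + x)" by auto
  then have d: "h x > 0" if "0 < x" "x < d" for x using that by (simp add: h_def)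
  \<comment> \<open>At multiples of \<pi> only the cosine term remains: h(\<pi>) = - c \<pi> and h(2
    \<pi>) = 2 c \<pi>. So the sign of c decides on which side of \<pi> a root is found.\<close>
  have "\<exists>t1>0. h t1 = 0 \<and> (\<beta> \<le> 1 \<longrightarrow> t1 \<le> pi)"
  proof (cases "\<beta> \<le> 1")
    case True
    define x where "x = min (d / 2) pi"
    have x: "0 < x" "x < d" "x \<le> pi" using \<open>d > 0\<close> by (auto simp: x_def)
    have "c \<ge> 0" using True \<open>\<beta> > 0\<close> by (simp add: c_def)
    then have "h pi \<le> 0" by (simp add: h_def)
    from IVT2'[OF this _ x(3) cont] d[OF x(1,2)] obtain t1 where "x \<le> t1" "t1 \<le> pi" "h t1 = 0" by auto
    then show ?thesis using x by (intro exI[of _ t1]) auto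
  next
    case False
    then have "c \<le> 0" using \<open>\<beta> > 0\<close> by (simp add: c_def)
    then have "h (2 * pi) \<le> 0" "0 \<le> h pi" by (simp_all add: h_def mult_nonpos_nonneg)
    from IVT2'[OF this _ cont] obtain t1 where "pi \<le> t1" "h t1 = 0" by auto
    then show ?thesis using False less_le_trans[OF pi_gt_zero] by (intro exI[of _ t1]) auto
  qed
  then obtain t1 where t1: "t1 > 0" "h t1 = 0" "\<beta> \<le> 1 \<longrightarrow> t1 \<le> pi" by blast
  \<comment> \<open>The lower end \<open>d / 2\<close> in place of 0 makes the set closed without
    losing any root up to \<open>t1\<close>.\<close>
  define K where "K = {t \<in> {d / 2..t1}. h t = 0}"
  have "K = {d / 2..t1} \<inter> h -` {0}" by (auto simp: K_def)
  then have "compact K"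
    using continuous_closed_preimage[OF cont[of "{d / 2..t1}"], of "{0}"]
    by (auto simp: compact_eq_bounded_closed intro: bounded_subset[of "{d / 2..t1}"])
  moreover have low: "d / 2 \<le> t" if "Z t" for t
    using d[of t] that \<open>d > 0\<close> by (cases "t < d") (auto simp: Z)
  then have "t1 \<in> K" using t1 Z by (simp add: K_def)
  ultimately obtain m where m: "m \<in> K" "\<And>t. t \<in> K \<Longrightarrow> m \<le> t"
    using compact_attains_inf[of K] by blast
  have Zm: "Z m" using m(1) \<open>d > 0\<close> by (auto simp: K_def Z)
  have "m \<le> t" if "Z t" for t
    using m(2)[of t] m(2)[OF \<open>t1 \<in> K\<close>] low[OF that] that by (cases "t \<le> t1") (auto simp: K_def Z)
  then have tr: "t_r \<alpha> = m"
    using Zm unfolding t_r_def c Z_def by (intro Least_equality) auto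
  show "0 < t_r \<alpha>" "sin (t_r \<alpha>) / t_r \<alpha> + (1 / \<beta> - 1) * cos (t_r \<alpha>) = 0"
    using Zm by (simp_all add: tr Z_def c_def)
  show "t_r \<alpha> \<le> pi" if "\<beta> \<le> 1"
    using m(2)[OF \<open>t1 \<in> K\<close>] t1 that by (simp add: tr)
  show "pi \<le> t_r \<alpha>" if "\<beta> \<ge> 1"
  proof (rule ccontr)
    assume "\<not> pi \<le> t_r \<alpha>"
    then have y: "0 < m" "m < pi" "h m = 0" using Zm by (auto simp: tr Z)
    have "0 \<le> sin m - m * cos m" using y by (intro sin_minus_x_cos_nonneg) simp_all
    moreover have "0 \<le> - c" using that by (simp add: c_def)
    ultimately have "0 \<le> - c * (sin m - m * cos m)" by (rule mult_nonneg_nonneg[rotated])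
    moreover have "0 < (1 + c) * sin m"
      using \<open>c > -1\<close> y by (intro mult_pos_pos sin_gt_zero) simp_all
    \<comment> \<open>For -1 < c \<le> 0 this splitting exhibits \<open>h m\<close> as a positive
      plus a nonnegative term.\<close>
    moreover have "h m = (1 + c) * sin m + - c * (sin m - m * cos m)"
      by (simp add: h_def algebra_simps)
    ultimately have "0 < h m" by linarith
    with y show False by simp
  qed
qed

subsection \<open>The direction of the theorem\<close>

text \<open>The matrix u v^T. Written with orthonormal vectors, the identities for H and S reduce to
  inner products, whatever the numbering of the index types.\<close>

definition outer :: "real^'m::finite \<Rightarrow> real^'n::finite \<Rightarrow> real^'n^'m" where
  "outer u v = (\<chi> i j. u $ i * v $ j)"

lemma outer_mult: "outer u v ** outer w z = (v \<bullet> w) *\<^sub>R outer u z"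
proof -
  have "(\<Sum>k\<in>UNIV. u $ i * v $ k * (w $ k * z $ j)) = (\<Sum>k\<in>UNIV. v $ k * w $ k) * (u $ i * z $ j)" for i j
    unfolding sum_distrib_right by (rule sum.cong) (simp_all add: mult_ac)
  then show ?thesis by (simp add: vec_eq_iff outer_def matrix_matrix_mult_def inner_vec_def)
qed

lemma transpose_outer: "transpose (outer u v) = outer v u"
  by (simp add: vec_eq_iff outer_def transpose_def mult.commute)

lemma inner_outer: "outer u v \<bullet> outer w z = (u \<bullet> w) * (v \<bullet> z)"
  by (simp add: outer_def inner_vec_def sum_product mult_ac) (rule sum.swap)

theorem theorem5p1:
  fixes \<beta> \<alpha> :: real
    and Q \<Omega> :: "real^('p::finite + 'q::finite)^('p + 'q)"
    and A \<Psi> :: "real^'p^'p"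
    and H :: "real^'p^'q"
    and \<xi> :: "real^'p^('p + 'q)"
    and \<gamma> :: "real \<Rightarrow> real^'p^('p + 'q)"
    and col :: "'p \<Rightarrow> nat" and row :: "'q \<Rightarrow> nat"
  assumes p_ge: "2 \<le> CARD('p)"
    and p_le: "CARD('p) + 2 \<le> CARD('p + 'q)"
    and beta: "\<beta> > 0"
    and alpha: "\<alpha> = 1 / (2 * \<beta>) - 1"
    and col: "bij_betw col UNIV {1..CARD('p)}"
    and row: "bij_betw row UNIV {1..CARD('q)}"
    and Q: "orthogonal_matrix Q"
    and A: "A = 0"
    and H: "H = (\<chi> i j. if row i = col j \<and> col j \<le> 2 then 1 else 0)"
    and xi: "\<xi> = Q ** stack A H"
    and Omega: "\<Omega> = block ((2 * \<beta>) *\<^sub>R A) (- transpose H) H 0"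
    and Psi: "\<Psi> = - ((1 - 2 * \<beta>) *\<^sub>R A)"
    and gamma: "\<And>t. \<gamma> t = Q ** matrix_exp (t *\<^sub>R \<Omega>) ** I_np ** matrix_exp (- (t *\<^sub>R \<Psi>))"
  shows
    "\<xi> \<in> stiefel_tangent (Q ** I_np) \<and>
     geodesic_from stiefel (stiefel_metric \<beta>) (Q ** I_np) \<xi> \<gamma> \<and>
     (\<forall>t. \<gamma> t = riem_exp stiefel (stiefel_metric \<beta>) (Q ** I_np) (t *\<^sub>R \<xi>)) \<and>
     \<Psi> = 0 \<and> (\<forall>t. \<gamma> t = Q ** matrix_exp (t *\<^sub>R \<Omega>) ** I_np) \<and>
     conjugate_along stiefel stiefel_tangent (stiefel_metric \<beta>) (Q ** I_np) \<xi> (t_r \<alpha>) \<and>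
     conjugate_along stiefel stiefel_tangent (stiefel_metric \<beta>) (Q ** I_np) \<xi> pi \<and>
     (\<forall>T>0. curve_length (stiefel_metric \<beta>) \<gamma> 0 T = T * sqrt 2) \<and>
     (\<exists>c. (\<forall>X::real^'p^('p + 'q) \<in> stiefel.
              conj_radius stiefel stiefel_tangent (stiefel_metric \<beta>) X = c) \<and>
          c \<le> ereal (min (t_r \<alpha>) pi * sqrt 2)) \<and>
     (\<beta> \<le> 1 \<longrightarrow> min (t_r \<alpha>) pi = t_r \<alpha>) \<and>
     (\<beta> \<ge> 1 \<longrightarrow> min (t_r \<alpha>) pi = pi)"
proof -
  let ?g = "stiefel_metric \<beta> :: real^'p^('p + 'q) \<Rightarrow> _"
  have "\<beta> \<noteq> 0" using beta by simp
  have sk: "skew (0 :: real^'p^'p)" by (simp add: skew_def transpose_simps)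
  have \<Psi>0: "\<Psi> = 0" by (simp add: Psi A)
  have \<Omega>0: "t *\<^sub>R \<Omega> = block ((2 * \<beta>) *\<^sub>R 0) (- transpose (t *\<^sub>R H)) (t *\<^sub>R H) 0" for t
    by (simp add: Omega A block_arith transpose_simps)
  have \<gamma>: "\<gamma> t = Q ** matrix_exp (t *\<^sub>R \<Omega>) ** I_np" for t by (simp add: gamma \<Psi>0)
  have tan: "\<xi> \<in> stiefel_tangent (Q ** I_np)" unfolding xi A by (rule stiefel_tangentI[OF Q sk])
  have "\<gamma> = (\<lambda>t. Q ** (matrix_exp (t *\<^sub>R block ((2 * \<beta>) *\<^sub>R 0) (- transpose H) H 0) **
      (I_np ** matrix_exp (t *\<^sub>R (1 - 2 * \<beta>) *\<^sub>R 0))))"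
    by (simp add: fun_eq_iff \<gamma> Omega A matrix_mul_assoc)
  then have geo: "geodesic_from stiefel ?g (Q ** I_np) \<xi> \<gamma>"
    using stiefel_geodesic_explicit[OF Q sk, of \<beta> H] by (simp add: xi A)
  have scale: "t *\<^sub>R \<xi> = Q ** stack 0 (t *\<^sub>R H)" for t
    by (simp add: xi A mat.scaleR_right[symmetric] stack_arith)
  have exp: "\<gamma> t = riem_exp stiefel ?g (Q ** I_np) (t *\<^sub>R \<xi>)" for t
    unfolding scale riem_exp_stiefel[OF \<open>\<beta> \<noteq> 0\<close> Q sk] \<Omega>0[symmetric] by (simp add: \<gamma> matrix_mul_assoc)

  \<comment> \<open>The matrix \<open>H\<close> in coordinates and its complex structure\<close>
  have "CARD('q) \<ge> 2" using p_le by simp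
  then have "1 \<in> range col" "2 \<in> range col" "1 \<in> range row" "2 \<in> range row"
    using col row p_ge by (auto simp: bij_betw_def)
  then obtain p1 p2 q1 q2 where p: "col p1 = 1" "col p2 = 2" and q: "row q1 = 1" "row q2 = 2"
    by (metis imageE)
  have col_eq: "col j = 1 \<longleftrightarrow> j = p1" "col j = 2 \<longleftrightarrow> j = p2" for j
    using col p by (auto simp: bij_betw_def inj_def)
  have row_eq: "row i = 1 \<longleftrightarrow> i = q1" "row i = 2 \<longleftrightarrow> i = q2" for i
    using row q by (auto simp: bij_betw_def inj_def)
  have ne: "p1 \<noteq> p2" "q1 \<noteq> q2" using p q by auto
  have col_pos: "col j \<ge> 1" for j using col by (auto simp: bij_betw_def)
  define e1 e2 :: "real^'p" and f1 f2 :: "real^'q"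
    where "e1 = axis p1 1" and "e2 = axis p2 1" and "f1 = axis q1 1" and "f2 = axis q2 1"
  have inner: "e1 \<bullet> e1 = 1" "e2 \<bullet> e2 = 1" "e1 \<bullet> e2 = 0" "e2 \<bullet> e1 = 0"
    "f1 \<bullet> f1 = 1" "f2 \<bullet> f2 = 1" "f1 \<bullet> f2 = 0" "f2 \<bullet> f1 = 0"
    using ne by (simp_all add: e1_def e2_def f1_def f2_def inner_axis_axis)
  have "(if row i = col j \<and> col j \<le> 2 then 1 else 0) =
      (if i = q1 then 1 else 0) * (if j = p1 then 1 else 0) + (if i = q2 then 1 else 0) * (if j = p2 then 1 else 0 :: real)"
    for i j
  proof -
    \<comment> \<open>The numbering starts at 1, so a number that is at most 2 is 1 or 2.\<close>
    have "row i = col j \<and> col j \<le> 2 \<longleftrightarrow> (row i = 1 \<and> col j = 1) \<or> (row i = 2 \<and> col j = 2)"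
      using col_pos[of j] by auto
    then show ?thesis unfolding col_eq row_eq using ne by auto
  qed
  then have H': "H = outer f1 e1 + outer f2 e2"
    by (simp add: H outer_def vec_eq_iff e1_def e2_def f1_def f2_def axis_def)
  \<comment> \<open>The quarter turn in the span of \<open>e1\<close> and \<open>e2\<close>,
    extended by 0; its square is minus the projection H^T H onto this plane.\<close>
  define S where "S = outer e2 e1 - outer e1 e2"
  note outer_simps = mat.add_left mat.add_right mat.diff_left mat.diff_right transpose_simps
    transpose_outer outer_mult inner
  have HH: "transpose H ** H = outer e1 e1 + outer e2 e2" by (simp add: H' outer_simps)
  have S: "transpose S = - S" "S ** S = - (transpose H ** H)" "S ** (transpose H ** H) = S"
    "H ** (transpose H ** H) = H"
    unfolding HH by (simp_all add: S_def H' outer_simps)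
  have "S \<bullet> S = 2" by (simp add: S_def inner_outer inner inner_diff_left inner_diff_right)
  then have "S \<noteq> 0" by auto
  have "H \<bullet> H = 2" by (simp add: H' inner_outer inner inner_add_left inner_add_right)

  \<comment> \<open>The two conjugate points\<close>
  have crit: "exp_critical stiefel stiefel_tangent ?g (Q ** I_np) (t *\<^sub>R \<xi>)"
    if "t > 0" "a \<noteq> 0 \<or> b \<noteq> 0" "a * ((1 - \<beta>) * cos t + \<beta> * (sin t / t)) = 0" "sin t / t * (t * (1 - \<beta>) * a + b) = 0"
    for t a b
    unfolding xi A by (rule stiefel_exp_critical[OF \<open>\<beta> \<noteq> 0\<close> Q S \<open>S \<noteq> 0\<close> that])
  note root = t_r_root[OF beta alpha]
  have crit_r: "exp_critical stiefel stiefel_tangent ?g (Q ** I_np) (t_r \<alpha> *\<^sub>R \<xi>)"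
  \<comment> \<open>The value of b makes the second equation hold identically; with a = 1 the first
    one is the equation of \<open>t_r \<alpha>\<close> multiplied by \<beta>.\<close>
  proof (rule crit[OF root(1), of 1 "- (t_r \<alpha> * (1 - \<beta>))"])
    have "(1 - \<beta>) * cos (t_r \<alpha>) + \<beta> * (sin (t_r \<alpha>) / t_r \<alpha>) =
        \<beta> * (sin (t_r \<alpha>) / t_r \<alpha> + (1 / \<beta> - 1) * cos (t_r \<alpha>))"
      using beta root(1) by (simp add: field_simps)
    then show "1 * ((1 - \<beta>) * cos (t_r \<alpha>) + \<beta> * (sin (t_r \<alpha>) / t_r \<alpha>)) = 0" by (simp add: root(2))
  qed simp_all
  \<comment> \<open>Here a = 0 settles the first equation and sin \<pi> = 0 the second.\<close>
  have crit_pi: "exp_critical stiefel stiefel_tangent ?g (Q ** I_np) (pi *\<^sub>R \<xi>)"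
    by (rule crit[of pi 0 1]) simp_all

  \<comment> \<open>The length of the geodesic\<close>
  have len: "curve_length ?g \<gamma> 0 T = T * sqrt 2" if "T > 0" for T
  proof -
    have "skew \<Omega>" by (simp add: skew_def Omega A transpose_block block_arith transpose_simps)
    then have orth: "orthogonal_matrix (Q ** matrix_exp (t *\<^sub>R \<Omega>))" for t
      by (intro orthogonal_matrix_mul Q orthogonal_matrix_exp_skew)
    have \<Omega>I: "\<Omega> ** I_np = stack 0 H"
      by (simp add: Omega A I_np_def block_mult_stack mat.zero_left mat.zero_right)
    have "(\<gamma> has_vector_derivative Q ** matrix_exp (t *\<^sub>R \<Omega>) ** stack 0 H) (at t)" for t
      unfolding \<gamma>[abs_def] \<Omega>I[symmetric]
      by (auto intro!: derivative_eq_intros matrix_exp_has_vector_derivative simp: mat_simps)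
        (simp add: matrix_mul_assoc[symmetric] matrix_exp_commute)
    then have vd: "vector_derivative \<gamma> (at t) = Q ** matrix_exp (t *\<^sub>R \<Omega>) ** stack 0 H" for t
      by (rule vector_derivative_at)
    \<comment> \<open>The matrix Q exp(t \<Omega>) is a frame at \<gamma>(t) in which the velocity
      keeps the blocks 0 and \<open>H\<close>, so the squared speed is constantly
      \<open>H \<bullet> H\<close>.\<close>
    have "?g (\<gamma> t) (vector_derivative \<gamma> (at t)) (vector_derivative \<gamma> (at t)) = 2" for t
      unfolding vd \<gamma> stiefel_metric_eq[OF orth] inner_matrix[symmetric] by (simp add: \<open>H \<bullet> H = 2\<close>)
    then show ?thesis using that by (simp add: curve_length_def)
  qed

  \<comment> \<open>The bound for the conjugate radius\<close>
  have radius: "conj_radius stiefel stiefel_tangent ?g (Q ** I_np) \<le> ereal (t * sqrt 2)"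
    if "t > 0" "exp_critical stiefel stiefel_tangent ?g (Q ** I_np) (t *\<^sub>R \<xi>)" for t
  proof -
    have "?g (Q ** I_np) (t *\<^sub>R \<xi>) (t *\<^sub>R \<xi>) = t\<^sup>2 * 2"
      unfolding scale stiefel_metric_eq[OF Q] inner_matrix[symmetric]
      by (simp add: \<open>H \<bullet> H = 2\<close> power2_eq_square)
    then have norm: "sqrt (?g (Q ** I_np) (t *\<^sub>R \<xi>) (t *\<^sub>R \<xi>)) = t * sqrt 2"
      using \<open>t > 0\<close> by (simp add: real_sqrt_mult)
    have tT: "t *\<^sub>R \<xi> \<in> stiefel_tangent (Q ** I_np)" using that(2) by (simp add: exp_critical_def)
    show ?thesis
      unfolding conj_radius_def
    \<comment> \<open>Every admissible ball omits the critical vector, so its radius is at most the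
      norm of that vector; the ball being open, equality is allowed.\<close>
    proof (rule Sup_least, clarify)
      fix r :: real
      assume "\<forall>v\<in>stiefel_tangent (Q ** I_np). sqrt (?g (Q ** I_np) v v) < r \<longrightarrow>
        \<not> exp_critical stiefel stiefel_tangent ?g (Q ** I_np) v"
      then have "\<not> sqrt (?g (Q ** I_np) (t *\<^sub>R \<xi>) (t *\<^sub>R \<xi>)) < r" using tT that(2) by blast
      then show "ereal r \<le> ereal (t * sqrt 2)" by (simp add: norm)
    qed
  qed
  have I: "I_np \<in> (stiefel :: (real^'p^('p + 'q)) set)" by (simp add: stiefel_def gram_I_np)
  have const: "conj_radius stiefel stiefel_tangent ?g X = conj_radius stiefel stiefel_tangent ?g (Q ** I_np)"
    if X: "X \<in> stiefel" for X
  proof -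
    obtain P where "orthogonal_matrix P" "X = P ** I_np" using X stiefel_completion by blast
    then show ?thesis
      using conj_radius_orthogonal[OF \<open>\<beta> \<noteq> 0\<close> _ I] Q by simp
  qed
  have "conj_radius stiefel stiefel_tangent ?g (Q ** I_np) \<le> ereal (min (t_r \<alpha>) pi * sqrt 2)"
    using radius[OF root(1) crit_r] radius[OF pi_gt_zero crit_pi] by (simp add: min_def)
  then show ?thesis
    using tan geo exp \<Psi>0 \<gamma> crit_r crit_pi len const root(3,4) by (auto simp: conjugate_along_def)
qed

end
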